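(* Let $0<\lambda<1/2$, let $K_\lambda\subset[0,1]$ be the unique nonempty compact set with $K_\lambda=\lambda K_\lambda\cup(\lambda K_\lambda+1-\lambda)$, let $C_\lambda=K_\lambda\times K_\lambda$, let $S^1=\{(x,y)\in\mathbb{R}^2:x^2+y^2=1\}$, and let $E_\lambda=C_\lambda\cap S^1$. Let $\lambda_\infty\approx 0.305854$ be the unique root in $(1/4,1/2)$ of $2x^3-3x^2+4x-1=0$, and set $\lambda_*:=\frac{\sqrt{3}-1}{2}$ and $\lambda_{\mathrm H}:=\sqrt{2}-1$. Then the following statements hold. (i) If $\lambda_\infty<\lambda<1/2$, then $E_\lambda$ is infinite. In fact, it contains a sequence of distinct points converging to $(0,1)$ and a symmetric sequence (obtained by interchanging coordinates) converging to $(1,0)$. (ii) If $\lambda_*<\lambda<1/2$, then $E_\lambda$ has the cardinality of the continuum. (iii) If $\lambda_{\mathrm H}<\lambda<1/2$, then $\dim_{\mathrm H}E_\lambda>0$. (iv) If $1/2-3\times10^{-9}\le\lambda<1/2$, then $$\dim_{\mathrm H}E_\lambda\ge 1-2102\,\frac{1-2\lambda}{\lambda}.$$ Consequently, $\lim_{\lambda\uparrow1/2}\dim_{\mathrm H}E_\lambda=1$.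
   Context: $\dim_{\mathrm H}$ denotes Hausdorff dimension. *)

theory Defs
  imports "HOL-Analysis.Analysis" "HOL-Library.Equipollence"
begin

text \<open>
  The gauge of a covering set. The empty set always contributes 0, and for \<open>s = 0\<close> a nonempty
  set contributes 1; this is needed because Isabelle has \<open>0 powr 0 = 0\<close>.
\<close>

definition diam_gauge :: "real \<Rightarrow> 'a::metric_space set \<Rightarrow> ennreal" where
  "diam_gauge s U = (if U = {} then 0 else if s = 0 then 1 else ennreal (diameter U powr s))"

text \<open>
  Covers are required to consist of bounded sets because \<^const>\<open>diameter\<close> is only meaningful for
  those. Finite covers are included: pad them with empty sets.
\<close>

definition hausdorff_premeasure :: "real \<Rightarrow> real \<Rightarrow> 'a::metric_space set \<Rightarrow> ennreal" where
  "hausdorff_premeasure \<delta> s A =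
     (INF U\<in>{U :: nat \<Rightarrow> 'a set. A \<subseteq> (\<Union>i. U i) \<and> (\<forall>i. bounded (U i) \<and> diameter (U i) \<le> \<delta>)}.
        (\<Sum>i. diam_gauge s (U i)))"

definition hausdorff_measure :: "real \<Rightarrow> 'a::metric_space set \<Rightarrow> ennreal" where
  "hausdorff_measure s A = (SUP \<delta>\<in>{0<..}. hausdorff_premeasure \<delta> s A)"

definition hausdorff_dim :: "'a::metric_space set \<Rightarrow> ereal" where
  "hausdorff_dim A = (INF s\<in>{s. 0 \<le> s \<and> hausdorff_measure s A = 0}. ereal s)"

definition cantor_equation :: "real \<Rightarrow> real set \<Rightarrow> bool" where
  "cantor_equation l K \<longleftrightarrow> K = (\<lambda>x. l * x) ` K \<union> (\<lambda>x. l * x + 1 - l) ` K"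

definition cantor_set :: "real \<Rightarrow> real set" where
  "cantor_set l = (THE K. compact K \<and> K \<noteq> {} \<and> cantor_equation l K)"

definition unit_circle :: "(real \<times> real) set" where
  "unit_circle = {(x, y). x\<^sup>2 + y\<^sup>2 = 1}"

definition cantor_circle :: "real \<Rightarrow> (real \<times> real) set" where
  "cantor_circle l = (cantor_set l \<times> cantor_set l) \<inter> unit_circle"

definition lambda_inf :: real where
  "lambda_inf = (THE x. 1/4 < x \<and> x < 1/2 \<and> 2 * x ^ 3 - 3 * x\<^sup>2 + 4 * x - 1 = 0)"

definition lambda_star :: real where
  "lambda_star = (sqrt 3 - 1) / 2"

definition lambda_H :: real where
  "lambda_H = sqrt 2 - 1"

lemma cantor_equation_subset:
  assumes l: "0 < l" "l < 1/2"
    and K: "compact K" "K \<noteq> {}" "cantor_equation l K"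
    and L: "compact L" "L \<noteq> {}" "cantor_equation l L"
  shows "K \<subseteq> L"
proof -
  have "continuous_on K (\<lambda>x. infdist x L)"
    by (intro continuous_intros)
  then obtain x where x: "x \<in> K" "\<And>y. y \<in> K \<Longrightarrow> infdist y L \<le> infdist x L"
    using continuous_attains_sup[OF K(1,2)] by blast
  from x(1) K(3) have "x \<in> (\<lambda>x. l * x) ` K \<union> (\<lambda>x. l * x + 1 - l) ` K"
    unfolding cantor_equation_def by blast
  then obtain y c where y: "y \<in> K" "x = l * y + c" and c: "c = 0 \<or> c = 1 - l"
    by (metis (no_types, lifting) Un_iff add.right_neutral add_diff_eq image_iff)
  obtain z where z: "z \<in> L" "infdist y L = dist y z"
    using infdist_attains_inf[of L y] L compact_imp_closed by blast
  have "l * z + c \<in> (\<lambda>x. l * x) ` L \<union> (\<lambda>x. l * x + 1 - l) ` L"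
    using c z(1) by (auto simp flip: add_diff_eq)
  then have "l * z + c \<in> L"
    using L(3) unfolding cantor_equation_def by blast
  then have "infdist x L \<le> dist x (l * z + c)"
    by (rule infdist_le)
  also have "\<dots> = l * infdist y L"
    using l by (simp add: y z dist_real_def abs_mult flip: right_diff_distrib)
  also have "\<dots> \<le> l * infdist x L"
    using l x(2)[OF y(1)] by (intro mult_left_mono) auto
  finally have "(1 - l) * infdist x L \<le> 0"
    by (simp add: algebra_simps)
  then have "infdist x L \<le> 0"
    using l by (simp add: mult_le_0_iff)
  then have "infdist w L = 0" if "w \<in> K" for w
    using x(2)[OF that] infdist_nonneg[of w L] by linarith
  then show ?thesis
    using L(1,2) in_closed_iff_infdist_zero compact_imp_closed by blast
qed

lemma cantor_equation_exists:
  assumes l: "0 < l" "l < 1/2"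
  shows "\<exists>K. compact K \<and> K \<noteq> {} \<and> cantor_equation l K \<and> K \<subseteq> {0..1}"
proof -
  define F where "F = (\<lambda>A. (\<lambda>x. l * x) ` A \<union> (\<lambda>x. l * x + 1 - l) ` A)"
  define A where "A n = (F ^^ n) {0..1}" for n
  define K where "K = (\<Inter>n. A n)"
  have A0: "A 0 = {0..1}" and AS: "A (Suc n) = F (A n)" for n
    by (simp_all add: A_def)
  have F_mono: "F X \<subseteq> F Y" if "X \<subseteq> Y" for X Y
    using that unfolding F_def by blast
  have step: "A (Suc n) \<subseteq> A n" for n
  proof (induction n)
    case 0
    have "l * x \<le> 1" if "x \<le> 1" "0 \<le> x" for x
      using mult_mono[of l 1 x 1] l that by simp
    moreover have "l * x \<le> l" if "x \<le> 1" "0 \<le> x" for x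
      using mult_left_mono[of x 1 l] l that by simp
    moreover have "l \<le> l * x + 1" if "0 \<le> x" for x
      using mult_nonneg_nonneg[of l x] l that by linarith
    ultimately show ?case
      using l by (auto simp: A0 AS F_def)
  next
    case (Suc n)
    then show ?case
      using F_mono AS by blast
  qed
  have anti: "A n \<subseteq> A m" if "m \<le> n" for m n
    using lift_Suc_antimono_le[of A, OF step that] .
  have cpt: "compact (A n)" for n
  proof (induction n)
    case (Suc n)
    then show ?case
      unfolding AS F_def
      by (intro compact_Un compact_continuous_image continuous_intros)
  qed (simp add: A0)
  have ne: "A n \<noteq> {}" for n
    by (induction n) (auto simp: A0 AS F_def)
  have "K \<noteq> {}"
    unfolding K_def by (rule compact_nest) (use cpt ne anti in auto)
  moreover have "compact K"
    unfolding K_def by (intro compact_Inter) (use cpt in auto)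
  moreover have "K \<subseteq> {0..1}"
    using A0 unfolding K_def by blast
  moreover have "K = F K"
  proof
    show "F K \<subseteq> K"
    proof -
      have "F K \<subseteq> A (Suc n)" for n
        unfolding AS by (rule F_mono) (auto simp: K_def)
      then show ?thesis
        using step unfolding K_def by blast
    qed
    show "K \<subseteq> F K"
    proof
      fix x assume "x \<in> K"
      then have xF: "x \<in> F (A n)" for n
        using AS unfolding K_def by blast
      have 1: "x \<in> (\<lambda>x. l * x) ` A n \<longleftrightarrow> x / l \<in> A n" for n
        using l by (auto simp: image_iff intro!: bexI[of _ "x / l"])
      have 2: "x \<in> (\<lambda>x. l * x + 1 - l) ` A n \<longleftrightarrow> (x - 1 + l) / l \<in> A n" for n
        using l by (auto simp: image_iff intro!: bexI[of _ "(x - 1 + l) / l"])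
      have *: "x / l \<in> A n \<or> (x - 1 + l) / l \<in> A n" for n
        using xF[of n] 1[of n] 2[of n] unfolding F_def by blast
      show "x \<in> F K"
      proof (cases "\<forall>n. x / l \<in> A n")
        case True
        then have "x / l \<in> K"
          by (simp add: K_def)
        moreover have "x = l * (x / l)"
          using l by simp
        ultimately show ?thesis
          unfolding F_def by blast
      next
        case False
        then obtain m where m: "x / l \<notin> A m"
          by blast
        have "(x - 1 + l) / l \<in> A n" for n
          using *[of "max m n"] m anti[of m "max m n"] anti[of n "max m n"] by auto
        then have "(x - 1 + l) / l \<in> K"
          by (simp add: K_def)
        moreover have "x = l * ((x - 1 + l) / l) + 1 - l"
          using l by simp
        ultimately show ?thesis
          unfolding F_def by blast
      qed
    qed
  qed
  ultimately show ?thesis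
    unfolding cantor_equation_def F_def by blast
qed

lemma cantor_set_ex1:
  assumes "0 < l" "l < 1/2"
  shows "\<exists>!K. compact K \<and> K \<noteq> {} \<and> cantor_equation l K"
  using cantor_equation_exists[OF assms] cantor_equation_subset[OF assms]
  by (metis subset_antisym)

lemma cantor_set_props:
  assumes "0 < l" "l < 1/2"
  shows "compact (cantor_set l)" "cantor_set l \<noteq> {}" "cantor_equation l (cantor_set l)"
    and "cantor_set l \<subseteq> {0..1}"
proof -
  note * = theI'[OF cantor_set_ex1[OF assms], folded cantor_set_def]
  from * show "compact (cantor_set l)" "cantor_set l \<noteq> {}" "cantor_equation l (cantor_set l)"
    by auto
  with * show "cantor_set l \<subseteq> {0..1}"
    using cantor_equation_exists[OF assms] cantor_equation_subset[OF assms] by blast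
qed

lemma lambda_inf_poly_strict_mono:
  fixes x y :: real
  assumes "x < y"
  shows "2 * x ^ 3 - 3 * x\<^sup>2 + 4 * x - 1 < 2 * y ^ 3 - 3 * y\<^sup>2 + 4 * y - 1"
proof -
  have "2 * (x\<^sup>2 + x * y + y\<^sup>2) - 3 * (x + y) + 4
      = (x + y - 3/2)\<^sup>2 + x\<^sup>2 + y\<^sup>2 + 7/4"
    by (simp add: power2_eq_square algebra_simps)
  also have "\<dots> > 0"
    by (intro add_nonneg_pos add_nonneg_nonneg) auto
  finally have "(y - x) * (2 * (x\<^sup>2 + x * y + y\<^sup>2) - 3 * (x + y) + 4) > 0"
    using assms by simp
  then show ?thesis
    by (simp add: power2_eq_square power3_eq_cube algebra_simps)
qed

lemma lambda_inf_exists: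
  "\<exists>x::real. 0.3058535 < x \<and> x < 0.3058545 \<and> 2 * x ^ 3 - 3 * x\<^sup>2 + 4 * x - 1 = 0"
proof -
  let ?p = "\<lambda>x::real. 2 * x ^ 3 - 3 * x\<^sup>2 + 4 * x - 1"
  have lo: "?p 0.3058535 < 0" and hi: "0 < ?p 0.3058545"
    by (simp_all add: power2_eq_square power3_eq_cube field_simps)
  have "\<exists>x\<ge>0.3058535. x \<le> 0.3058545 \<and> ?p x = 0"
    by (rule IVT') (use lo hi in \<open>auto intro!: continuous_intros\<close>)
  then obtain x where x: "0.3058535 \<le> x" "x \<le> 0.3058545" "?p x = 0"
    by blast
  have "x \<noteq> 0.3058535" "x \<noteq> 0.3058545"
    using lo hi x(3) less_irrefl by metis+
  with x show ?thesis
    by (intro exI[of _ x]) auto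
qed

lemma lambda_inf_ex1:
  "\<exists>!x::real. 1/4 < x \<and> x < 1/2 \<and> 2 * x ^ 3 - 3 * x\<^sup>2 + 4 * x - 1 = 0"
proof -
  obtain x :: real where "0.3058535 < x" "x < 0.3058545" "2 * x ^ 3 - 3 * x\<^sup>2 + 4 * x - 1 = 0"
    using lambda_inf_exists by blast
  then show ?thesis
    by (intro ex1I[of _ x]) (auto, metis lambda_inf_poly_strict_mono less_irrefl linorder_neqE)
qed

lemma lambda_inf_approx: "\<bar>lambda_inf - 0.305854\<bar> < 0.0000005"
proof -
  obtain x :: real where x: "0.3058535 < x" "x < 0.3058545" "2 * x ^ 3 - 3 * x\<^sup>2 + 4 * x - 1 = 0"
    using lambda_inf_exists by blast
  then have "lambda_inf = x"
    unfolding lambda_inf_def by (intro the1_equality[OF lambda_inf_ex1]) auto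
  with x(1,2) show ?thesis
    by (intro iffD2[OF abs_less_iff] conjI) (simp_all add: field_simps)
qed

end

theory Submission
  imports Defs
begin

text \<open>
  Write a point of the circle as \<open>x = l ^ N * a\<close> and \<open>y = 1 - l ^ (2 * N) * c\<close>. The equation of the circle
  becomes \<open>a\<^sup>2 / 2 = c - e * c\<^sup>2 / 2\<close> with \<open>e = l ^ (2 * N)\<close>, and since the Cantor set \<open>K\<close> is mapped
  into itself by \<open>x \<mapsto> l * x\<close> and by \<open>x \<mapsto> 1 - x\<close>, every solution with \<open>a\<close> and \<open>c\<close> in \<open>K\<close> is a point
  of \<open>K \<times> K\<close> on the circle. After restriction to one Cantor interval for \<open>a\<close> and one of equal level
  for \<open>c\<close>, this asks for coincidences \<open>\<phi> x = \<psi> y\<close> with \<open>x, y \<in> K\<close>, where \<open>\<phi>\<close> and \<open>\<psi>\<close> are increasing,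
  the slope of \<open>\<phi>\<close> is about \<open>a\<close>, and the slope of \<open>\<psi>\<close> is about 1 if \<open>e\<close> is small.

  Coincidences are found by descent. Take two Cantor intervals of the same level whose images \<open>A\<close>
  under \<open>\<phi>\<close> and \<open>B\<close> under \<open>\<psi>\<close> meet, remove the middle gap from each, and see which of the four
  pairs of children still have images that meet. A nested sequence of such pairs shrinks to a
  coincidence, and the number of surviving pairs governs the dimension.

  \<^item> One pair survives as soon as \<open>A\<close> does not fit into the gap of \<open>B\<close> and the gap of \<open>A\<close> is no longer
    than a child of \<open>B\<close>. For \<open>a \<in> {1 - l..1 - l + l\<^sup>2}\<close> and \<open>e \<rightarrow> 0\<close> the critical inequality is
    \<open>(1 - 2 * l) * (1 - l + l\<^sup>2) < l\<close>, which is \<open>2 * l ^ 3 - 3 * l\<^sup>2 + 4 * l - 1 > 0\<close>. This gives one point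
    for every large \<open>N\<close> (\<open>coincidence_exists\<close>, \<open>sequence_to_pole\<close>).

  \<^item> If the slope of \<open>\<phi>\<close> stays strictly between \<open>(1 - 2 * l) / l\<close> and \<open>l / (1 - l - l\<^sup>2)\<close>, then either
    two pairs survive, or one survives and the margin by which its images meet, relative to their
    size, has grown by a fixed factor. So the total of a small power of this margin grows
    exponentially down the tree, and the dimension is positive (\<open>coincidence_dim_pos\<close>). The window of slopes is nonempty exactly if
    \<open>2 * l\<^sup>2 + 2 * l > 1\<close>, that is, for \<open>l > lambda_star\<close>; it then contains the point \<open>1 / (1 + l)\<close> of \<open>K\<close>,
    and there are intervals around this point and around \<open>l / (1 + l)\<close> from which to start
    (\<open>E_dim_pos\<close>). Since \<open>lambda_star < lambda_H\<close>, this is more than the third claim, and it implies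
    the second because an uncountable compact set has the cardinality of the continuum.

  \<^item> For \<open>l\<close> near 1/2 take the length of \<open>A \<inter> B\<close> as weight. Passing to the children loses only what
    lies in the two gaps, and nothing at all if the overlap is short. The relative loss is at most
    \<open>6 * \<theta>\<close> with \<open>\<theta> = (1 - 2 * l) / l\<close>, hence the dimension is at least \<open>1 - C * \<theta>\<close>, and \<open>C = 2102\<close> is
    ample (\<open>coincidence_dim_overlap\<close>, \<open>E_dim_ge\<close>). The dimension never exceeds 1 on the circle, so
    it tends to 1.

  Both dimension estimates use \<open>hausdorff_dim_ge_weighted_tree\<close>, a mass distribution principle that
  is itself proved by descent, without constructing a measure.
\<close>

section \<open>Hausdorff dimension and cardinality\<close>

text \<open>
  Covers by sets of diameter at most 1 suffice: for those the gauge only grows when the exponent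
  decreases, so a positive premeasure at \<open>s\<close> excludes measure zero for every smaller exponent,
  including the separately defined exponent 0.
\<close>

lemma hausdorff_dim_ge:
  fixes A :: "'a::metric_space set"
  assumes s: "0 < s" and pos: "0 < hausdorff_premeasure 1 s A"
  shows "ereal s \<le> hausdorff_dim A"
  unfolding hausdorff_dim_def
proof (rule INF_greatest)
  fix t assume "t \<in> {t. 0 \<le> t \<and> hausdorff_measure t A = 0}"
  then have t: "0 \<le> t" "hausdorff_measure t A = 0"
    by auto
  have gauge: "diam_gauge s U \<le> diam_gauge t U"
    if "t < s" "bounded U" "diameter U \<le> 1" for U :: "'a set"
  proof -
    have "diameter U \<ge> 0"
      using that(2) by (rule diameter_ge_0)
    then have "diameter U powr s \<le> diameter U powr t"
      using that(1,3) by (cases "diameter U = 0") (auto intro: powr_mono_both' powr_mono')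
    moreover have "diameter U powr s \<le> 1"
      using \<open>0 \<le> diameter U\<close> that(3) s by (intro powr_le1) auto
    ultimately show ?thesis
      using s by (auto simp: diam_gauge_def intro: ennreal_leI)
  qed
  show "ereal s \<le> ereal t"
  proof (rule ccontr)
    assume "\<not> ereal s \<le> ereal t"
    then have "t < s"
      by simp
    then have "hausdorff_premeasure 1 s A \<le> hausdorff_premeasure 1 t A"
      unfolding hausdorff_premeasure_def
      by (intro INF_mono) (auto intro!: suminf_le gauge)
    also have "\<dots> \<le> hausdorff_measure t A"
      unfolding hausdorff_measure_def by (rule SUP_upper) simp
    finally show False
      using pos t(2) by simp
  qed
qed

lemma hausdorff_dim_le:
  assumes "0 \<le> s" "\<And>t. s < t \<Longrightarrow> hausdorff_measure t A = 0"
  shows "hausdorff_dim A \<le> ereal s"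
proof (rule ereal_le_epsilon2)
  fix e :: real assume "0 < e"
  then have "s + e \<in> {t. 0 \<le> t \<and> hausdorff_measure t A = 0}"
    using assms by simp
  then show "hausdorff_dim A \<le> ereal s + ereal e"
    unfolding hausdorff_dim_def by (auto intro: INF_lower)
qed

lemma hausdorff_dim_countable:
  fixes A :: "'a::metric_space set"
  assumes "countable A"
  shows "hausdorff_dim A \<le> 0"
proof -
  have "hausdorff_measure t A = 0" if "0 < t" for t
  proof -
    define U where "U i = (if A = {} then {} else {from_nat_into A i})" for i
    have "A \<subseteq> (\<Union>i. U i)"
      using assms by (auto simp: U_def) (metis from_nat_into_surj)
    moreover have "bounded (U i) \<and> diameter (U i) \<le> \<delta>" if "\<delta> > 0" for i \<delta>
      using that by (auto simp: U_def)
    moreover have "(\<lambda>i. diam_gauge t (U i)) = (\<lambda>i. 0)"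
      using that by (intro ext) (simp add: U_def diam_gauge_def)
    then have "(\<Sum>i. diam_gauge t (U i)) = 0"
      by simp
    ultimately have "hausdorff_premeasure \<delta> t A \<le> 0" if "\<delta> > 0" for \<delta>
      unfolding hausdorff_premeasure_def using that
      by (intro INF_lower2[of U]) auto
    then show ?thesis
      unfolding hausdorff_measure_def by (simp add: SUP_eq_iff)
  qed
  then have "hausdorff_dim A \<le> ereal 0"
    by (intro hausdorff_dim_le) auto
  then show ?thesis
    by (simp add: zero_ereal_def)
qed

text \<open>
  Cutting the parameter interval into \<open>M\<close> equal parts gives \<open>M\<close> pieces of diameter at most \<open>L / M\<close>, whose
  gauges add up to a multiple of \<open>M powr (1 - t)\<close>. This tends to 0 for \<open>t > 1\<close>.
\<close>

lemma hausdorff_dim_lipschitz_curve: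
  fixes f :: "real \<Rightarrow> 'a::metric_space"
  assumes L: "\<And>u v. dist (f u) (f v) \<le> L * \<bar>u - v\<bar>" and A: "A \<subseteq> f ` {0..1}"
  shows "hausdorff_dim A \<le> 1"
proof -
  have "0 \<le> L"
    using L[of 0 1] zero_le_dist[of "f 0" "f 1"] by (simp del: zero_le_dist)
  have "hausdorff_measure t A = 0" if t: "1 < t" for t
  proof -
    have "hausdorff_premeasure \<delta> t A = 0" if \<delta>: "\<delta> > 0" for \<delta>
    proof -
      define U where "U M i = (if i < M then f ` {real i / real M..real (Suc i) / real M} else {})" for M i
      have bd: "bounded (U M i)" "diameter (U M i) \<le> L / real M" if "M > 0" for M i
      proof -
        have d: "dist x y \<le> L / real M" if "x \<in> U M i" "y \<in> U M i" for x y
        proof -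
          obtain u v where uv: "x = f u" "y = f v"
            "u \<in> {real i / real M..real (Suc i) / real M}" "v \<in> {real i / real M..real (Suc i) / real M}"
            using \<open>x \<in> _\<close> \<open>y \<in> _\<close> by (auto simp: U_def split: if_splits)
          then have "\<bar>u - v\<bar> \<le> real (Suc i) / real M - real i / real M"
            by auto
          also have "\<dots> = 1 / real M"
            by (simp add: diff_divide_distrib[symmetric])
          finally have "L * \<bar>u - v\<bar> \<le> L * (1 / real M)"
            using \<open>0 \<le> L\<close> by (intro mult_left_mono)
          with L[of u v] uv(1,2) show ?thesis
            by simp
        qed
        show "bounded (U M i)"
          using d by (metis bounded_two_points)
        show "diameter (U M i) \<le> L / real M"
          unfolding diameter_def using d \<open>0 \<le> L\<close>
          by (auto intro!: cSUP_least)
      qed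
      have cov: "A \<subseteq> (\<Union>i. U M i)" if "M > 0" for M
      proof
        fix x assume "x \<in> A"
        then obtain u where u: "x = f u" "0 \<le> u" "u \<le> 1"
          using A by auto
        define i where "i = (if u = 1 then M - 1 else nat \<lfloor>u * real M\<rfloor>)"
        have "i < M \<and> real i \<le> u * real M \<and> u * real M \<le> real i + 1"
        proof (cases "u = 1")
          case False
          then have "u * real M < real M"
            using u that by simp
          moreover have "0 \<le> u * real M"
            using u by simp
          ultimately show ?thesis
            using False by (auto simp: i_def) linarith+
        qed (use that in \<open>auto simp: i_def\<close>)
        then have "x \<in> U M i"
          using that u by (auto simp: U_def field_simps)
        then show "x \<in> (\<Union>i. U M i)"
          by blast
      qed
      have le: "hausdorff_premeasure \<delta> t A \<le> ennreal (L powr t * real M powr (1 - t))"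
        if M: "M > 0" "L / real M \<le> \<delta>" for M
      proof -
        have "hausdorff_premeasure \<delta> t A \<le> (\<Sum>i. diam_gauge t (U M i))"
          unfolding hausdorff_premeasure_def
          by (rule INF_lower) (use cov[OF M(1)] bd[OF M(1)] M(2) in \<open>auto intro: order_trans\<close>)
        also have "\<dots> = (\<Sum>i<M. diam_gauge t (U M i))"
          by (rule suminf_finite) (auto simp: U_def diam_gauge_def)
        also have "\<dots> \<le> (\<Sum>i<M. ennreal ((L / real M) powr t))"
          using t bd[OF M(1)] diameter_ge_0[OF bd(1)[OF M(1)]]
          by (intro sum_mono) (auto simp: diam_gauge_def intro!: ennreal_leI powr_mono2)
        also have "\<dots> = ennreal (real M * (L / real M) powr t)"
          by (simp add: ennreal_mult ennreal_of_nat_eq_real_of_nat)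
        also have "real M * (L / real M) powr t = L powr t * real M powr (1 - t)"
          using M(1) \<open>0 \<le> L\<close> by (simp add: powr_divide powr_diff)
        finally show ?thesis .
      qed
      have "((\<lambda>M. ennreal (L powr t * real M powr (1 - t))) \<longlongrightarrow> ennreal (L powr t * 0)) at_top"
        using t by (intro tendsto_ennrealI tendsto_mult_left tendsto_neg_powr filterlim_real_sequentially) auto
      moreover have "\<forall>\<^sub>F M in at_top. hausdorff_premeasure \<delta> t A \<le> ennreal (L powr t * real M powr (1 - t))"
      proof -
        have "((\<lambda>M. L / real M) \<longlongrightarrow> 0) at_top"
          by (rule lim_const_over_n)
        then have "\<forall>\<^sub>F M in at_top. L / real M < \<delta>"
          using \<delta> by (auto dest: order_tendstoD)
        then show ?thesis
          using eventually_gt_at_top[of 0] by eventually_elim (auto intro: le)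
      qed
      ultimately have "hausdorff_premeasure \<delta> t A \<le> 0"
        using tendsto_lowerbound[of "\<lambda>M. ennreal (L powr t * real M powr (1 - t))" "ennreal (L powr t * 0)" at_top]
        by simp
      then show ?thesis by simp
    qed
    then show ?thesis
      unfolding hausdorff_measure_def by (simp add: SUP_eq_iff)
  qed
  then have "hausdorff_dim A \<le> ereal 1"
    by (intro hausdorff_dim_le) auto
  then show ?thesis
    by (simp add: one_ereal_def)
qed

text \<open>
  The condensation points of \<open>S\<close> form a nonempty perfect set \<open>P\<close>: by Lindelof's theorem only countably
  many points of \<open>S\<close> have a neighbourhood in which \<open>S\<close> is countable, and removing them cannot make
  any of the remaining points isolated.
\<close>

lemma uncountable_compact_continuum:
  fixes S :: "'a::polish_space set"
  assumes "compact S" "uncountable S"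
  shows "(UNIV :: real set) \<lesssim> S"
proof -
  define N where "N = {x. \<exists>U. open U \<and> x \<in> U \<and> countable (S \<inter> U)}"
  define P where "P = S - N"
  obtain F where F: "F \<subseteq> {U. open U \<and> countable (S \<inter> U)}" "countable F" "\<Union>F = \<Union>{U. open U \<and> countable (S \<inter> U)}"
    using Lindelof[of "{U. open U \<and> countable (S \<inter> U)}"] by auto
  have N: "N = \<Union>F"
    unfolding F(3) N_def by auto
  have "open N"
    unfolding N using F(1) by auto
  have "countable (S \<inter> N)"
    unfolding N Int_Union using F by (intro countable_UN) auto
  have big: "uncountable (P \<inter> U)" if "open U" "x \<in> U" "x \<in> P" for x U
  proof
    assume "countable (P \<inter> U)"
    then have "countable ((P \<inter> U) \<union> (S \<inter> N))"
      using \<open>countable (S \<inter> N)\<close> by simp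
    then have "countable (S \<inter> U)"
      by (rule countable_subset[rotated]) (auto simp: P_def)
    with that show False
      by (auto simp: P_def N_def)
  qed
  have "compact P"
    unfolding P_def using \<open>compact S\<close> \<open>open N\<close> by (rule compact_diff)
  have "P \<noteq> {}"
  proof
    assume "P = {}"
    then have "S = S \<inter> N"
      by (auto simp: P_def)
    with \<open>countable (S \<inter> N)\<close> assms(2) show False
      by simp
  qed
  have limpt: "x islimpt P" if "x \<in> P" for x
    unfolding islimpt_def
  proof (intro allI impI)
    fix T assume T: "x \<in> T" "open T"
    have "\<not> P \<inter> T \<subseteq> {x}"
      using big[OF T(2,1) that] by (meson countable_empty countable_insert countable_subset)
    then show "\<exists>y\<in>P. y \<in> T \<and> y \<noteq> x"
      by auto
  qed
  have "euclidean derived_set_of P = {x. x islimpt P}"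
    by (auto simp: derived_set_of_def islimpt_def)
  also have "\<dots> = P"
    using limpt compact_imp_closed[OF \<open>compact P\<close>] by (auto simp: closed_limpt)
  finally have "euclidean derived_set_of P = P" .
  then show ?thesis
    using lepoll_perfect_set[OF disjI1[OF completely_metrizable_space_euclidean] _ \<open>P \<noteq> {}\<close>]
      subset_imp_lepoll[of P S] lepoll_trans unfolding P_def by blast
qed

section \<open>Cantor intervals and the mass distribution principle\<close>

locale cantor_ratio =
  fixes l :: real
  assumes l: "0 < l" "l < 1/2"
begin

abbreviation K :: "real set" where
  "K \<equiv> cantor_set l"

lemma K_closed: "closed K"
  using cantor_set_props(1)[OF l] by (rule compact_imp_closed)

lemma K_eq: "K = (\<lambda>x. l * x) ` K \<union> (\<lambda>x. l * x + 1 - l) ` K"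
  using cantor_set_props(3)[OF l] unfolding cantor_equation_def .

lemma K_left: "x \<in> K \<Longrightarrow> l * x \<in> K"
  using K_eq by blast

lemma K_right: assumes "x \<in> K" shows "1 - l + l * x \<in> K"
proof -
  have "l * x + 1 - l \<in> K"
    using K_eq assms by blast
  then show ?thesis
    by (simp add: algebra_simps)
qed

lemma K_left_power: "x \<in> K \<Longrightarrow> l ^ n * x \<in> K"
  by (induction n) (use K_left in \<open>auto simp: mult.assoc\<close>)

lemma l_power_tendsto_0: "(\<lambda>n. l ^ n) \<longlonglongrightarrow> 0"
  using l by (intro LIMSEQ_power_zero) simp

lemma K_zero: "0 \<in> K"
proof -
  obtain x where "x \<in> K"
    using cantor_set_props(2)[OF l] by blast
  moreover have "(\<lambda>n. l ^ n * x) \<longlonglongrightarrow> 0"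
    using tendsto_mult_right[OF l_power_tendsto_0, of x] by simp
  ultimately show ?thesis
    using closed_sequentially[OF K_closed, of "\<lambda>n. l ^ n * x" 0] K_left_power by blast
qed

text \<open>
  The mirror image of \<open>K\<close> solves the same equation, in which the two maps change places, so uniqueness
  applies.
\<close>

lemma K_mirror:
  assumes "x \<in> K"
  shows "1 - x \<in> K"
proof -
  let ?M = "(\<lambda>x. 1 - x) ` K"
  have "?M = (\<lambda>x. 1 - x) ` ((\<lambda>x. l * x) ` K \<union> (\<lambda>x. l * x + 1 - l) ` K)"
    using K_eq by simp
  also have "\<dots> = (\<lambda>x. l * x) ` ?M \<union> (\<lambda>x. l * x + 1 - l) ` ?M"
    by (simp add: image_Un image_image algebra_simps Un_commute)
  finally have "cantor_equation l ?M"
    unfolding cantor_equation_def .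
  moreover have "compact ?M"
    by (intro compact_continuous_image continuous_intros cantor_set_props(1)[OF l])
  ultimately have "?M \<subseteq> K"
    using cantor_equation_subset[OF l _ _ _ cantor_set_props(1-3)[OF l]] cantor_set_props(2)[OF l]
    by blast
  with assms show ?thesis
    by blast
qed

text \<open>
  The tree of Cantor intervals, each represented by its left endpoint. An interval of level \<open>n\<close> is
  \<open>cell n a\<close> with \<open>a \<in> lefts n\<close>; its two children are the cells of level \<open>n + 1\<close> at the points of
  \<open>kids n a\<close>.
\<close>

definition kids :: "nat \<Rightarrow> real \<Rightarrow> real set" where
  "kids n a = {a, a + (1 - l) * l ^ n}"

primrec lefts :: "nat \<Rightarrow> real set" where
  "lefts 0 = {0}"
| "lefts (Suc n) = (\<Union>a\<in>lefts n. kids n a)"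

abbreviation cell :: "nat \<Rightarrow> real \<Rightarrow> real set" where
  "cell n a \<equiv> {a..a + l ^ n}"

lemma finite_kids: "finite (kids n a)"
  by (simp add: kids_def)

lemma kid_cell:
  assumes "a' \<in> kids n a"
  shows "cell (Suc n) a' \<subseteq> cell n a" "a \<le> a'" "a' + l ^ Suc n \<le> a + l ^ n"
proof -
  have "0 \<le> (1 - l) * l ^ n"
    using l by simp
  then show "a \<le> a'" "a' + l ^ Suc n \<le> a + l ^ n"
    using assms by (auto simp: kids_def algebra_simps)
  then show "cell (Suc n) a' \<subseteq> cell n a"
    by auto
qed

lemma kids_apart:
  assumes "a1 \<in> kids n a" "a2 \<in> kids n a" "a1 \<noteq> a2" "x1 \<in> cell (Suc n) a1" "x2 \<in> cell (Suc n) a2"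
  shows "(1 - 2 * l) * l ^ n \<le> \<bar>x1 - x2\<bar>"
  using assms by (auto simp: kids_def algebra_simps)

lemma lefts_bounds: "a \<in> lefts n \<Longrightarrow> 0 \<le> a \<and> a + l ^ n \<le> 1"
proof (induction n arbitrary: a)
  case (Suc n)
  then obtain b where "b \<in> lefts n" "a \<in> kids n b"
    by auto
  with Suc.IH[of b] kid_cell[of a n b] show ?case
    by linarith
qed simp

text \<open>
  Each cell carries a scaled copy of \<open>K\<close>. With \<open>y = 0\<close> this puts the left endpoints into \<open>K\<close>, which is
  all that is needed to see that nested cells shrink to a point of \<open>K\<close>.
\<close>

lemma lefts_shift: "a \<in> lefts n \<Longrightarrow> y \<in> K \<Longrightarrow> a + l ^ n * y \<in> K"
proof (induction n arbitrary: a y)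
  case (Suc n)
  then obtain b where b: "b \<in> lefts n" "a = b \<or> a = b + (1 - l) * l ^ n"
    by (auto simp: kids_def)
  have "b + l ^ n * (l * y) \<in> K" "b + l ^ n * (1 - l + l * y) \<in> K"
    using Suc b(1) K_left K_right by blast+
  moreover have "a + l ^ Suc n * y = b + l ^ n * (l * y) \<or> a + l ^ Suc n * y = b + l ^ n * (1 - l + l * y)"
    using b(2) by (auto simp: algebra_simps)
  ultimately show ?case
    by metis
qed simp

lemma nested_cells_limit:
  assumes a: "\<And>n. a n \<in> lefts n" "\<And>n. a (Suc n) \<in> kids n (a n)"
  obtains x where "x \<in> K" "\<And>n. x \<in> cell n (a n)"
proof -
  have "incseq a"
    using kid_cell(2)[OF a(2)] by (intro incseq_SucI)
  moreover have le: "a m \<le> a n + l ^ n" for m n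
  proof -
    have "a (n + k) + l ^ (n + k) \<le> a n + l ^ n" for k
    proof (induction k)
      case (Suc k)
      then show ?case
        using kid_cell(3)[OF a(2), of "n + k"] by simp
    qed simp
    from this[of m] \<open>incseq a\<close>[THEN incseqD, of m "n + m"] show ?thesis
      using zero_less_power[OF l(1), of "n + m"] by simp
  qed
  ultimately obtain x where x: "a \<longlonglongrightarrow> x" "\<And>n. a n \<le> x"
    using incseq_convergent[of a "a 0 + l ^ 0"] by blast
  have "x \<in> K"
    using closed_sequentially[OF K_closed _ x(1)] lefts_shift[OF a(1) K_zero] by simp
  moreover have "x \<in> cell n (a n)" for n
    using x(2)[of n] LIMSEQ_le_const2[OF x(1), of "a n + l ^ n"] le by auto
  ultimately show ?thesis
    by (rule that)
qed

lemma descending_cells: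
  assumes start: "R 0 0 0"
    and step: "\<And>n a b. \<lbrakk>a \<in> lefts n; b \<in> lefts n; R n a b\<rbrakk> \<Longrightarrow>
      \<exists>a'\<in>kids n a. \<exists>b'\<in>kids n b. R (Suc n) a' b'"
  obtains x y where "x \<in> K" "y \<in> K"
    "\<And>n. \<exists>a\<in>lefts n. \<exists>b\<in>lefts n. R n a b \<and> x \<in> cell n a \<and> y \<in> cell n b"
proof -
  let ?P = "\<lambda>n (a, b). a \<in> lefts n \<and> b \<in> lefts n \<and> R n a b"
  have "\<exists>f. \<forall>n. ?P n (f n) \<and> (fst (f (Suc n)) \<in> kids n (fst (f n)) \<and> snd (f (Suc n)) \<in> kids n (snd (f n)))"
  proof (rule dependent_nat_choice)
    show "\<exists>p. ?P 0 p"
      using start by auto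
    fix p n assume "?P n p"
    then show "\<exists>q. ?P (Suc n) q \<and> (fst q \<in> kids n (fst p) \<and> snd q \<in> kids n (snd p))"
      using step[of "fst p" n "snd p"] by (fastforce split: prod.splits)
  qed
  then obtain f where f: "\<And>n. fst (f n) \<in> lefts n \<and> snd (f n) \<in> lefts n \<and> R n (fst (f n)) (snd (f n))"
    "\<And>n. fst (f (Suc n)) \<in> kids n (fst (f n))" "\<And>n. snd (f (Suc n)) \<in> kids n (snd (f n))"
    by (auto simp: case_prod_beta)
  obtain x where "x \<in> K" "\<And>n. x \<in> cell n (fst (f n))"
    using nested_cells_limit[of "\<lambda>n. fst (f n)"] f by blast
  moreover obtain y where "y \<in> K" "\<And>n. y \<in> cell n (snd (f n))"
    using nested_cells_limit[of "\<lambda>n. snd (f n)"] f by blast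
  ultimately show ?thesis
    using f(1) by (intro that[of x y]) blast+
qed

text \<open>
  A mass distribution principle. The weight \<open>g\<close> of a pair of cells is at most the total weight of its
  four pairs of children, like the mass of an outer measure, and it decays like the \<open>s\<close>-th power of
  the size of the cells.

  Given a countable cover, each covering set \<open>U\<close> is charged at the deepest level \<open>m\<close> down to which it is
  too small to reach two different children of the same pair. Its cost is the bound on the weights at that
  level, which is comparable to the \<open>s\<close>-th power of the diameter of \<open>U\<close>. The total cost of the sets that
  meet a pair and are charged at its level or deeper splits among the children. If for the root it is
  less than the weight, then the same holds for some child, and so on. The limit point of these pairs would be
  covered by some \<open>U\<close>, and the pair at the level of \<open>U\<close> would have a weight greater than the bound.
\<close>

lemma hausdorff_dim_ge_weighted_tree:
  fixes g :: "nat \<Rightarrow> real \<Rightarrow> real \<Rightarrow> real" and F :: "real \<times> real \<Rightarrow> 'a::metric_space"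
  assumes s: "0 < s" and \<kappa>: "0 < \<kappa>"
    and F: "\<And>z w. \<kappa> * dist z w \<le> dist (F z) (F w)"
    and root: "0 < g 0 0 0"
    and nonneg: "\<And>n a b. 0 \<le> g n a b"
    and split: "\<And>n a b. \<lbrakk>a \<in> lefts n; b \<in> lefts n; 0 < g n a b\<rbrakk> \<Longrightarrow>
      g n a b \<le> (\<Sum>(a', b')\<in>kids n a \<times> kids n b. g (Suc n) a' b')"
    and bound: "\<And>n a b. \<lbrakk>a \<in> lefts n; b \<in> lefts n\<rbrakk> \<Longrightarrow> g n a b \<le> C * (l ^ n) powr s"
    and S: "\<And>x y. \<lbrakk>x \<in> K; y \<in> K;
        \<And>n. \<exists>a\<in>lefts n. \<exists>b\<in>lefts n. 0 < g n a b \<and> x \<in> cell n a \<and> y \<in> cell n b\<rbrakk> \<Longrightarrow> F (x, y) \<in> S"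
  shows "ereal s \<le> hausdorff_dim S"
proof (rule hausdorff_dim_ge[OF s])
  define D where "D = \<kappa> * (1 - 2 * l)"
  have D: "0 < D"
    using \<kappa> l by (simp add: D_def)
  have C: "0 < C"
    using bound[of 0 0 0] root by simp
  define c where "c = C / D powr s"
  have c: "0 < c"
    using C D by (simp add: c_def)
  define g0 where "g0 = g 0 0 0"
  have g0: "0 < g0"
    using root by (simp add: g0_def)
  have "ennreal (g0 / (2 * c)) \<le> (\<Sum>i. diam_gauge s (U i))"
    if cover: "S \<subseteq> (\<Union>i. U i)" and bdd: "\<And>i. bounded (U i)" for U :: "nat \<Rightarrow> 'a set"
  proof (rule ccontr)
    assume "\<not> ?thesis"
    then have small: "(\<Sum>i. diam_gauge s (U i)) < ennreal (g0 / (2 * c))"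
      by simp
    let ?d = "\<lambda>i. diameter (U i)"
    have d: "0 \<le> ?d i" for i
      using bdd by (rule diameter_ge_0)
    \<comment> \<open>A set of diameter 0 has no deepest level. It is charged so deep that its cost is below an arbitrary small share of the weight.\<close>
    have "\<exists>m. (\<forall>n<m. ?d i < D * l ^ n) \<and> C * (l ^ m) powr s \<le> c * ?d i powr s + (g0 / 2) * (1 / 2) ^ Suc i" for i
    proof (cases "?d i = 0")
      case True
      have "l powr s < 1"
        using l s powr_less_mono2[of s l 1] by simp
      then obtain m where m: "(l powr s) ^ m < (g0 / 2) * (1 / 2) ^ Suc i / C"
        using real_arch_pow_inv[of "(g0 / 2) * (1 / 2) ^ Suc i / C" "l powr s"] C g0 by auto
      have "(l powr s) ^ m = (l ^ m) powr s"
        using l by (simp add: powr_powr powr_realpow[symmetric] mult.commute)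
      then have "C * (l ^ m) powr s \<le> (g0 / 2) * (1 / 2) ^ Suc i"
        using m C by (simp add: field_simps)
      with True D l s show ?thesis
        by (intro exI[of _ m]) auto
    next
      case False
      then have pos: "0 < ?d i"
        using d[of i] by simp
      then obtain n where "l ^ n < ?d i / D"
        using real_arch_pow_inv[of "?d i / D" l] D l by auto
      then have ex: "D * l ^ n \<le> ?d i"
        using D by (simp add: field_simps)
      define m where "m = (LEAST n. D * l ^ n \<le> ?d i)"
      have m: "D * l ^ m \<le> ?d i"
        unfolding m_def using ex by (rule LeastI)
      have "?d i < D * l ^ n" if "n < m" for n
        using not_less_Least[of n "\<lambda>n. D * l ^ n \<le> ?d i"] that unfolding m_def by simp
      moreover have "C * (l ^ m) powr s \<le> C * (?d i / D) powr s"
        using m C D l s by (intro mult_left_mono powr_mono2) (auto simp: field_simps)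
      then have "C * (l ^ m) powr s \<le> c * ?d i powr s"
        using pos D by (simp add: c_def powr_divide)
      moreover have "0 \<le> (g0 / 2) * (1 / 2) ^ Suc i"
        using g0 by simp
      ultimately show ?thesis
        by (intro exI[of _ m]) (auto intro: order_trans)
    qed
    then obtain m where m: "\<And>i n. n < m i \<Longrightarrow> ?d i < D * l ^ n"
      and w: "\<And>i. C * (l ^ m i) powr s \<le> c * ?d i powr s + (g0 / 2) * (1 / 2) ^ Suc i"
      by metis
    define meets where "meets i n a b \<longleftrightarrow> n \<le> m i \<and> (\<exists>x\<in>cell n a. \<exists>y\<in>cell n b. F (x, y) \<in> U i)" for i n a b
    define cost where "cost i n a b = (if meets i n a b then ennreal (C * (l ^ m i) powr s) else 0)" for i n a b
    define total where "total n a b = (\<Sum>i. cost i n a b)" for n a b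

    have "total 0 0 0 \<le> (\<Sum>i. ennreal c * diam_gauge s (U i) + ennreal ((g0 / 2) * (1 / 2) ^ Suc i))"
      unfolding total_def
    proof (intro suminf_le summableI)
      fix i
      have "diam_gauge s (U i) = ennreal (?d i powr s)"
        using s by (simp add: diam_gauge_def)
      then have "ennreal c * diam_gauge s (U i) + ennreal ((g0 / 2) * (1 / 2) ^ Suc i)
          = ennreal (c * ?d i powr s + (g0 / 2) * (1 / 2) ^ Suc i)"
        using c g0 by (simp add: ennreal_mult ennreal_plus)
      then show "cost i 0 0 0 \<le> ennreal c * diam_gauge s (U i) + ennreal ((g0 / 2) * (1 / 2) ^ Suc i)"
        using w[of i] by (auto simp: cost_def intro: ennreal_leI)
    qed
    also have "\<dots> = ennreal c * (\<Sum>i. diam_gauge s (U i)) + (\<Sum>i. ennreal ((g0 / 2) * (1 / 2) ^ Suc i))"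
      by (subst suminf_add[symmetric]) auto
    also have "(\<Sum>i. ennreal ((g0 / 2) * (1 / 2) ^ Suc i)) = ennreal (g0 / 2)"
      using sums_mult[OF power_half_series, of "g0 / 2"] g0 by (intro suminf_ennreal_eq) auto
    also have "ennreal c * (\<Sum>i. diam_gauge s (U i)) + ennreal (g0 / 2) < ennreal g0"
    proof -
      obtain r where r: "(\<Sum>i. diam_gauge s (U i)) = ennreal r" "0 \<le> r"
        using small by (cases "\<Sum>i. diam_gauge s (U i)") auto
      with small have "r < g0 / (2 * c)"
        by (simp add: ennreal_less_iff)
      then have "c * r + g0 / 2 < g0"
        using c by (simp add: field_simps)
      then show ?thesis
        using r c g0 by (simp add: ennreal_mult[symmetric] ennreal_plus[symmetric] ennreal_less_iff del: ennreal_plus)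
    qed
    finally have start: "total 0 0 0 < ennreal (g 0 0 0)"
      by (simp add: g0_def)

    have at_most_one: "p = q"
      if mt: "meets i (Suc n) (fst p) (snd p)" "meets i (Suc n) (fst q) (snd q)" and
        "p \<in> kids n a \<times> kids n b" "q \<in> kids n a \<times> kids n b" for i n a b p q
    proof (rule ccontr)
      assume "p \<noteq> q"
      obtain x y x' y' where xy: "x \<in> cell (Suc n) (fst p)" "y \<in> cell (Suc n) (snd p)" "F (x, y) \<in> U i"
        "x' \<in> cell (Suc n) (fst q)" "y' \<in> cell (Suc n) (snd q)" "F (x', y') \<in> U i" "n < m i"
        using mt unfolding meets_def by auto
      have "(1 - 2 * l) * l ^ n \<le> \<bar>x - x'\<bar> \<or> (1 - 2 * l) * l ^ n \<le> \<bar>y - y'\<bar>"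
      proof (cases "fst p = fst q")
        case True
        then have "snd p \<noteq> snd q"
          using \<open>p \<noteq> q\<close> by (simp add: prod_eq_iff)
        then show ?thesis
          using that(3,4) xy(2,5) kids_apart[of "snd p" n b "snd q" y y'] by (metis mem_Times_iff)
      next
        case False
        then show ?thesis
          using that(3,4) xy(1,4) kids_apart[of "fst p" n a "fst q" x x'] by (metis mem_Times_iff)
      qed
      then have "(1 - 2 * l) * l ^ n \<le> dist (x, y) (x', y')"
        using dist_fst_le[of "(x, y)" "(x', y')"] dist_snd_le[of "(x, y)" "(x', y')"]
        by (auto simp: dist_real_def)
      then have "D * l ^ n \<le> \<kappa> * dist (x, y) (x', y')"
        using \<kappa> by (simp add: D_def mult.assoc)
      also have "\<dots> \<le> dist (F (x, y)) (F (x', y'))"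
        by (rule F)
      also have "\<dots> \<le> ?d i"
        using bdd xy by (intro diameter_bounded_bound)
      also have "\<dots> < D * l ^ n"
        using xy by (intro m)
      finally show False
        by simp
    qed
    have meets_parent: "meets i n a b"
      if mt: "meets i (Suc n) (fst p) (snd p)" and "p \<in> kids n a \<times> kids n b" for i n a b p
    proof -
      have "cell (Suc n) (fst p) \<subseteq> cell n a" "cell (Suc n) (snd p) \<subseteq> cell n b"
        using that(2) kid_cell(1) by (metis mem_Times_iff)+
      moreover obtain x y where "x \<in> cell (Suc n) (fst p)" "y \<in> cell (Suc n) (snd p)" "F (x, y) \<in> U i"
        "Suc n \<le> m i"
        using mt unfolding meets_def by blast
      ultimately show ?thesis
        unfolding meets_def by (intro conjI bexI[of _ x] bexI[of _ y]) auto
    qed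
    have cost_split: "(\<Sum>p\<in>kids n a \<times> kids n b. cost i (Suc n) (fst p) (snd p)) \<le> cost i n a b" for i n a b
    proof (cases "\<exists>p\<in>kids n a \<times> kids n b. meets i (Suc n) (fst p) (snd p)")
      case True
      then obtain p where p: "p \<in> kids n a \<times> kids n b" "meets i (Suc n) (fst p) (snd p)"
        by blast
      have "(\<Sum>q\<in>kids n a \<times> kids n b. cost i (Suc n) (fst q) (snd q)) = (\<Sum>q\<in>{p}. cost i (Suc n) (fst q) (snd q))"
      proof (rule sum.mono_neutral_right)
        show "\<forall>q\<in>kids n a \<times> kids n b - {p}. cost i (Suc n) (fst q) (snd q) = 0"
          using at_most_one[OF _ p(2) _ p(1)] unfolding cost_def by (metis DiffE insertCI)
      qed (use p(1) finite_kids in auto)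
      then show ?thesis
        using p meets_parent[OF p(2,1)] by (simp add: cost_def)
    next
      case False
      then have "(\<Sum>p\<in>kids n a \<times> kids n b. cost i (Suc n) (fst p) (snd p)) = 0"
        unfolding cost_def by (intro sum.neutral) (metis (full_types))
      then show ?thesis
        by simp
    qed
    have total_split: "(\<Sum>p\<in>kids n a \<times> kids n b. total (Suc n) (fst p) (snd p)) \<le> total n a b" for n a b
      unfolding total_def
      by (subst suminf_sum[symmetric]) (intro summableI suminf_le cost_split)+

    have positive: "0 < g n a b" if "total n a b < ennreal (g n a b)" for n a b
      using that by (cases "0 < g n a b") (auto simp: ennreal_neg)
    have step: "\<exists>a'\<in>kids n a. \<exists>b'\<in>kids n b. total (Suc n) a' b' < ennreal (g (Suc n) a' b')"
      if ab: "a \<in> lefts n" "b \<in> lefts n" and lt: "total n a b < ennreal (g n a b)" for n a b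
    proof (rule ccontr)
      assume "\<not> ?thesis"
      then have ge: "ennreal (g (Suc n) (fst p) (snd p)) \<le> total (Suc n) (fst p) (snd p)"
        if "p \<in> kids n a \<times> kids n b" for p
        using that by (auto simp: not_less)
      have "0 < g n a b"
        using lt by (rule positive)
      then have "g n a b \<le> (\<Sum>p\<in>kids n a \<times> kids n b. g (Suc n) (fst p) (snd p))"
        using split[OF ab] by (simp add: case_prod_beta)
      then have "ennreal (g n a b) \<le> (\<Sum>p\<in>kids n a \<times> kids n b. ennreal (g (Suc n) (fst p) (snd p)))"
        using nonneg by (subst sum_ennreal) (auto intro: ennreal_leI)
      also have "\<dots> \<le> (\<Sum>p\<in>kids n a \<times> kids n b. total (Suc n) (fst p) (snd p))"
        by (intro sum_mono ge)
      also have "\<dots> \<le> total n a b"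
        by (rule total_split)
      finally show False
        using lt by simp
    qed

    obtain x y where xy: "x \<in> K" "y \<in> K"
      "\<And>n. \<exists>a\<in>lefts n. \<exists>b\<in>lefts n. total n a b < ennreal (g n a b) \<and> x \<in> cell n a \<and> y \<in> cell n b"
      using descending_cells[of "\<lambda>n a b. total n a b < ennreal (g n a b)", OF start step] by blast
    have "F (x, y) \<in> S"
    proof (rule S[OF xy(1,2)])
      fix n
      show "\<exists>a\<in>lefts n. \<exists>b\<in>lefts n. 0 < g n a b \<and> x \<in> cell n a \<and> y \<in> cell n b"
        using xy(3)[of n] positive by blast
    qed
    then obtain i where i: "F (x, y) \<in> U i"
      using cover by auto
    obtain a b where ab: "a \<in> lefts (m i)" "b \<in> lefts (m i)" "total (m i) a b < ennreal (g (m i) a b)"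
      "x \<in> cell (m i) a" "y \<in> cell (m i) b"
      using xy(3) by blast
    have "ennreal (g (m i) a b) \<le> ennreal (C * (l ^ m i) powr s)"
      by (intro ennreal_leI bound ab)
    also have "\<dots> = cost i (m i) a b"
      using ab i unfolding cost_def meets_def by auto
    also have "\<dots> \<le> total (m i) a b"
      unfolding total_def
      using sum_le_suminf[of "\<lambda>j. cost j (m i) a b" "{i}"] by simp
    finally show False
      using ab(3) by simp
  qed
  then have "ennreal (g0 / (2 * c)) \<le> hausdorff_premeasure 1 s S"
    unfolding hausdorff_premeasure_def by (intro INF_greatest) auto
  moreover have "0 < ennreal (g0 / (2 * c))"
    using g0 c by simp
  ultimately show "0 < hausdorff_premeasure 1 s S"
    by (rule less_le_trans[rotated])
qed

end

section \<open>Coincidences of two increasing functions on the Cantor set\<close>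

text \<open>
  In this part the points \<open>u0, u1, u2, u3\<close> are the ends of an interval and of its gap, which leaves the
  children from \<open>u0\<close> to \<open>u1\<close> and from \<open>u2\<close> to \<open>u3\<close>; similarly for \<open>v\<close>.

  An asymmetric form of the gap lemma. The interval \<open>u\<close> is too long to lie inside the gap of \<open>v\<close>, so it
  meets a child of \<open>v\<close>; that child is too long to lie inside the gap of \<open>u\<close>, so it meets a child of \<open>u\<close>.
\<close>

lemma linked_intervals_split:
  fixes u0 u1 u2 u3 v0 v1 v2 v3 :: real
  assumes "u0 \<le> u1" "u1 \<le> u2" "u2 \<le> u3" "v0 \<le> v1" "v1 \<le> v2" "v2 \<le> v3"
    and "u0 \<le> v3" "v0 \<le> u3"
    and "v2 - v1 \<le> u3 - u0" "u2 - u1 \<le> v1 - v0" "u2 - u1 \<le> v3 - v2"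
  shows "(u0 \<le> v1 \<and> v0 \<le> u1) \<or> (u0 \<le> v3 \<and> v2 \<le> u1) \<or> (u2 \<le> v1 \<and> v0 \<le> u3) \<or> (u2 \<le> v3 \<and> v2 \<le> u3)"
  using assms by linarith

definition overlap :: "real \<Rightarrow> real \<Rightarrow> real \<Rightarrow> real \<Rightarrow> real" where
  "overlap a b c d = max 0 (min b d - max a c)"

lemma overlap_nonneg: "0 \<le> overlap a b c d"
  by (simp add: overlap_def)

lemma overlap_cut_left:
  assumes "u0 \<le> u1" "u1 \<le> u2" "u2 \<le> u3"
  shows "overlap u0 u3 c d \<le> overlap u0 u1 c d + overlap u2 u3 c d + (u2 - u1)"
  using assms unfolding overlap_def by linarith

lemma overlap_commute: "overlap a b c d = overlap c d a b"
  by (simp add: overlap_def min.commute max.commute)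

lemma overlap_cut:
  assumes u: "u0 \<le> u1" "u1 \<le> u2" "u2 \<le> u3" and v: "v0 \<le> v1" "v1 \<le> v2" "v2 \<le> v3"
  shows "overlap u0 u3 v0 v3 \<le> overlap u0 u1 v0 v1 + overlap u0 u1 v2 v3
    + overlap u2 u3 v0 v1 + overlap u2 u3 v2 v3 + ((u2 - u1) + 2 * (v2 - v1))"
  using overlap_cut_left[OF u, of v0 v3] overlap_cut_left[OF v, of u0 u1] overlap_cut_left[OF v, of u2 u3]
  by (simp add: overlap_commute[of v0] overlap_commute[of v2])

text \<open>
  If the overlap is shorter than all four children, then neither interval contains the other. They
  overlap at the ends, within one pair of children, and the gaps cost nothing.
\<close>

lemma overlap_cut_small:
  assumes "u0 \<le> u1" "u1 \<le> u2" "u2 \<le> u3" "v0 \<le> v1" "v1 \<le> v2" "v2 \<le> v3"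
    and "w \<le> u1 - u0" "w \<le> u3 - u2" "w \<le> v1 - v0" "w \<le> v3 - v2"
    and small: "overlap u0 u3 v0 v3 < w"
  shows "overlap u0 u3 v0 v3 \<le> overlap u0 u1 v0 v1 + overlap u0 u1 v2 v3
    + overlap u2 u3 v0 v1 + overlap u2 u3 v2 v3"
proof (cases "overlap u0 u3 v0 v3 = 0")
  case False
  then have pos: "0 < min u3 v3 - max u0 v0" "min u3 v3 - max u0 v0 < w"
    and eq: "overlap u0 u3 v0 v3 = min u3 v3 - max u0 v0"
    using small by (auto simp: overlap_def max_def split: if_splits)
  have "overlap u0 u3 v0 v3 = overlap u0 u1 v2 v3 \<or> overlap u0 u3 v0 v3 = overlap u2 u3 v0 v1"
  proof (cases "u0 \<le> v0")
    case True
    then have "u2 \<le> v0" "u3 \<le> v1"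
      using assms pos by (auto simp: min_def max_def split: if_splits)
    then show ?thesis
      using True assms(1-10) pos unfolding eq overlap_def by (simp add: min_def max_def)
  next
    case False
    then have "v2 \<le> u0" "v3 \<le> u1"
      using assms pos by (auto simp: min_def max_def split: if_splits)
    then show ?thesis
      using False assms(1-10) pos unfolding eq overlap_def by (simp add: min_def max_def)
  qed
  then show ?thesis
    using overlap_nonneg[of u0 u1 v0 v1] overlap_nonneg[of u0 u1 v2 v3] overlap_nonneg[of u2 u3 v0 v1]
      overlap_nonneg[of u2 u3 v2 v3] by linarith
qed (use overlap_nonneg in \<open>simp add: add_nonneg_nonneg\<close>)

text \<open>
  The distance by which \<open>{a..b}\<close> may be shifted in either direction before it loses contact with
  \<open>{c..d}\<close>. For intervals that meet this is the overlap, except that it may be larger if one interval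
  contains the other.
\<close>

definition margin :: "real \<Rightarrow> real \<Rightarrow> real \<Rightarrow> real \<Rightarrow> real" where
  "margin a b c d = min (d - a) (b - c)"

text \<open>
  Each child of \<open>u\<close> exceeds the gap of \<open>v\<close> by \<open>2 * d\<close>, so it reaches at least \<open>d\<close> deep into some child of
  \<open>v\<close>, unless it leaves \<open>v\<close>. The latter is excluded because the inner ends \<open>u1\<close> and \<open>u2\<close> are at least \<open>d\<close>
  away from the outer ends of \<open>v\<close> in the relevant direction. So both children of \<open>u\<close> belong to a
  surviving pair.
\<close>

lemma margin_two_kids:
  fixes d :: real
  assumes "u0 \<le> u1" "u1 \<le> u2" "u2 \<le> u3" "v0 \<le> v1" "v1 \<le> v2" "v2 \<le> v3"
    and "v2 - v1 + 2 * d \<le> u1 - u0" "v2 - v1 + 2 * d \<le> u3 - u2"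
    and "u2 - u0 + d \<le> v3 - u0" "u3 - u1 + d \<le> u3 - v0" "0 \<le> d"
  shows "d \<le> margin u0 u1 v2 v3 \<and> d \<le> margin u2 u3 v2 v3 \<or>
    d \<le> margin u2 u3 v2 v3 \<and> d \<le> margin u0 u1 v0 v1 \<or>
    d \<le> margin u0 u1 v0 v1 \<and> d \<le> margin u2 u3 v0 v1"
  using assms unfolding margin_def min.bounded_iff by linarith

text \<open>
  For a pair of children at the extreme end: \<open>s\<close> is the distance that limits the margin \<open>m\<close> of the
  parents, it is unchanged in the children, and \<open>t\<close> is the sum of their lengths. With \<open>c = r * l\<close> this says that
  relative to the size of the cells, which shrinks by \<open>l\<close>, the margin grows by \<open>r\<close>.
\<close>

lemma margin_grows:
  fixes c :: real
  assumes c: "0 \<le> c" "c \<le> 1" and m: "0 \<le> m" "m \<le> s" and s: "(1 + c) * s \<le> t"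
  shows "c * m \<le> min s (t - s)"
proof -
  have "c * m \<le> c * s"
    using c m by (intro mult_left_mono)
  moreover have "c * s \<le> 1 * s"
    using c m by (intro mult_right_mono) auto
  ultimately show ?thesis
    using s by (simp add: algebra_simps)
qed

context cantor_ratio
begin

lemma sum_kids:
  "(\<Sum>(a', b')\<in>kids n a \<times> kids n b. f a' b') = f a b + f a (b + (1 - l) * l ^ n)
    + f (a + (1 - l) * l ^ n) b + f (a + (1 - l) * l ^ n) (b + (1 - l) * l ^ n)"
proof -
  have "(1 - l) * l ^ n \<noteq> 0"
    using l by simp
  then show ?thesis
    unfolding kids_def sum.cartesian_product[symmetric] by (simp add: add.assoc)
qed

lemma powr_power: "(l ^ n) powr s = (l powr s) ^ n"
  using l by (simp add: powr_powr powr_realpow[symmetric] mult.commute)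

end

locale increasing_pair = cantor_ratio +
  fixes \<phi> \<psi> :: "real \<Rightarrow> real" and p P q Q :: real
  assumes slopes: "0 < p" "0 < q"
    and \<phi>: "\<And>x y. \<lbrakk>0 \<le> x; x \<le> y; y \<le> 1\<rbrakk> \<Longrightarrow> p * (y - x) \<le> \<phi> y - \<phi> x \<and> \<phi> y - \<phi> x \<le> P * (y - x)"
    and \<psi>: "\<And>x y. \<lbrakk>0 \<le> x; x \<le> y; y \<le> 1\<rbrakk> \<Longrightarrow> q * (y - x) \<le> \<psi> y - \<psi> x \<and> \<psi> y - \<psi> x \<le> Q * (y - x)"
begin

lemma slopes_le: "p \<le> P" "q \<le> Q"
  using \<phi>[of 0 1] \<psi>[of 0 1] by auto

text \<open>
  Lengths of the images of a cell, of its two children and of its gap. The gap lies between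
  \<open>a + l * l ^ n\<close> and \<open>a + (1 - l) * l ^ n\<close>.
\<close>

lemma cell_images:
  assumes "a \<in> lefts n"
  defines "a1 \<equiv> a + l * l ^ n" and "a2 \<equiv> a + (1 - l) * l ^ n" and "a3 \<equiv> a + l ^ n"
  shows "p * l * l ^ n \<le> \<phi> a1 - \<phi> a" "\<phi> a1 - \<phi> a \<le> P * l * l ^ n"
    "p * (1 - 2 * l) * l ^ n \<le> \<phi> a2 - \<phi> a1" "\<phi> a2 - \<phi> a1 \<le> P * (1 - 2 * l) * l ^ n"
    "p * l * l ^ n \<le> \<phi> a3 - \<phi> a2" "\<phi> a3 - \<phi> a2 \<le> P * l * l ^ n"
    "p * l ^ n \<le> \<phi> a3 - \<phi> a" "\<phi> a3 - \<phi> a \<le> P * l ^ n"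
    "q * l * l ^ n \<le> \<psi> a1 - \<psi> a" "\<psi> a1 - \<psi> a \<le> Q * l * l ^ n"
    "q * (1 - 2 * l) * l ^ n \<le> \<psi> a2 - \<psi> a1" "\<psi> a2 - \<psi> a1 \<le> Q * (1 - 2 * l) * l ^ n"
    "q * l * l ^ n \<le> \<psi> a3 - \<psi> a2" "\<psi> a3 - \<psi> a2 \<le> Q * l * l ^ n"
    "q * l ^ n \<le> \<psi> a3 - \<psi> a" "\<psi> a3 - \<psi> a \<le> Q * l ^ n"
proof -
  have pos: "0 \<le> l * l ^ n" "0 \<le> (1 - 2 * l) * l ^ n" "0 \<le> l ^ n"
    using l by auto
  have diffs: "a1 - a = l * l ^ n" "a2 - a1 = (1 - 2 * l) * l ^ n" "a3 - a2 = l * l ^ n" "a3 - a = l ^ n"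
    by (auto simp: a1_def a2_def a3_def algebra_simps)
  have "0 \<le> a" "a \<le> a1" "a1 \<le> a2" "a2 \<le> a3" "a3 \<le> 1"
    using lefts_bounds[OF assms(1)] diffs pos unfolding a3_def by linarith+
  then have *: "p * (a1 - a) \<le> \<phi> a1 - \<phi> a \<and> \<phi> a1 - \<phi> a \<le> P * (a1 - a)"
     "p * (a2 - a1) \<le> \<phi> a2 - \<phi> a1 \<and> \<phi> a2 - \<phi> a1 \<le> P * (a2 - a1)"
     "p * (a3 - a2) \<le> \<phi> a3 - \<phi> a2 \<and> \<phi> a3 - \<phi> a2 \<le> P * (a3 - a2)"
     "p * (a3 - a) \<le> \<phi> a3 - \<phi> a \<and> \<phi> a3 - \<phi> a \<le> P * (a3 - a)"
     "q * (a1 - a) \<le> \<psi> a1 - \<psi> a \<and> \<psi> a1 - \<psi> a \<le> Q * (a1 - a)"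
     "q * (a2 - a1) \<le> \<psi> a2 - \<psi> a1 \<and> \<psi> a2 - \<psi> a1 \<le> Q * (a2 - a1)"
     "q * (a3 - a2) \<le> \<psi> a3 - \<psi> a2 \<and> \<psi> a3 - \<psi> a2 \<le> Q * (a3 - a2)"
     "q * (a3 - a) \<le> \<psi> a3 - \<psi> a \<and> \<psi> a3 - \<psi> a \<le> Q * (a3 - a)"
    by (intro \<phi> \<psi>; linarith)+
  then show "p * l * l ^ n \<le> \<phi> a1 - \<phi> a" "\<phi> a1 - \<phi> a \<le> P * l * l ^ n"
    "p * (1 - 2 * l) * l ^ n \<le> \<phi> a2 - \<phi> a1" "\<phi> a2 - \<phi> a1 \<le> P * (1 - 2 * l) * l ^ n"
    "p * l * l ^ n \<le> \<phi> a3 - \<phi> a2" "\<phi> a3 - \<phi> a2 \<le> P * l * l ^ n"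
    "p * l ^ n \<le> \<phi> a3 - \<phi> a" "\<phi> a3 - \<phi> a \<le> P * l ^ n"
    "q * l * l ^ n \<le> \<psi> a1 - \<psi> a" "\<psi> a1 - \<psi> a \<le> Q * l * l ^ n"
    "q * (1 - 2 * l) * l ^ n \<le> \<psi> a2 - \<psi> a1" "\<psi> a2 - \<psi> a1 \<le> Q * (1 - 2 * l) * l ^ n"
    "q * l * l ^ n \<le> \<psi> a3 - \<psi> a2" "\<psi> a3 - \<psi> a2 \<le> Q * l * l ^ n"
    "q * l ^ n \<le> \<psi> a3 - \<psi> a" "\<psi> a3 - \<psi> a \<le> Q * l ^ n"
    unfolding diffs by (auto simp: mult.assoc)
qed

lemma cell_images_increasing:
  assumes "a \<in> lefts n"
  shows "\<phi> a \<le> \<phi> (a + l * l ^ n)" "\<phi> (a + l * l ^ n) \<le> \<phi> (a + (1 - l) * l ^ n)"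
    "\<phi> (a + (1 - l) * l ^ n) \<le> \<phi> (a + l ^ n)"
    "\<psi> a \<le> \<psi> (a + l * l ^ n)" "\<psi> (a + l * l ^ n) \<le> \<psi> (a + (1 - l) * l ^ n)"
    "\<psi> (a + (1 - l) * l ^ n) \<le> \<psi> (a + l ^ n)"
proof -
  have "0 \<le> p * l * l ^ n" "0 \<le> q * l * l ^ n" "0 \<le> p * (1 - 2 * l) * l ^ n" "0 \<le> q * (1 - 2 * l) * l ^ n"
    using l slopes by auto
  then show "\<phi> a \<le> \<phi> (a + l * l ^ n)" "\<phi> (a + l * l ^ n) \<le> \<phi> (a + (1 - l) * l ^ n)"
    "\<phi> (a + (1 - l) * l ^ n) \<le> \<phi> (a + l ^ n)"
    "\<psi> a \<le> \<psi> (a + l * l ^ n)" "\<psi> (a + l * l ^ n) \<le> \<psi> (a + (1 - l) * l ^ n)"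
    "\<psi> (a + (1 - l) * l ^ n) \<le> \<psi> (a + l ^ n)"
    using cell_images[OF assms] by linarith+
qed

definition linked :: "nat \<Rightarrow> real \<Rightarrow> real \<Rightarrow> bool" where
  "linked n a b \<longleftrightarrow> \<phi> a \<le> \<psi> (b + l ^ n) \<and> \<psi> b \<le> \<phi> (a + l ^ n)"

lemma linked_limit:
  assumes chain: "\<And>n. \<exists>a\<in>lefts n. \<exists>b\<in>lefts n. linked n a b \<and> x \<in> cell n a \<and> y \<in> cell n b"
  shows "\<phi> x = \<psi> y"
proof -
  have "\<bar>\<phi> x - \<psi> y\<bar> \<le> (P + Q) * l ^ n" for n
  proof -
    obtain a b where ab: "a \<in> lefts n" "b \<in> lefts n" "linked n a b" "x \<in> cell n a" "y \<in> cell n b"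
      using chain by blast
    have "0 \<le> a" "a + l ^ n \<le> 1" "0 \<le> b" "b + l ^ n \<le> 1" "a \<le> x" "x \<le> a + l ^ n" "b \<le> y" "y \<le> b + l ^ n"
      using lefts_bounds ab by auto
    then have "p * (x - a) \<le> \<phi> x - \<phi> a" "p * (a + l ^ n - x) \<le> \<phi> (a + l ^ n) - \<phi> x"
      "q * (y - b) \<le> \<psi> y - \<psi> b" "q * (b + l ^ n - y) \<le> \<psi> (b + l ^ n) - \<psi> y"
      "0 \<le> p * (x - a)" "0 \<le> p * (a + l ^ n - x)" "0 \<le> q * (y - b)" "0 \<le> q * (b + l ^ n - y)"
      using \<phi>[of a x] \<phi>[of x "a + l ^ n"] \<psi>[of b y] \<psi>[of y "b + l ^ n"] slopes by auto
    then show ?thesis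
      using ab(3) cell_images(8)[OF ab(1)] cell_images(16)[OF ab(2)]
      unfolding linked_def by (auto simp: abs_le_iff algebra_simps)
  qed
  moreover have "(\<lambda>n. (P + Q) * l ^ n) \<longlonglongrightarrow> 0"
    using tendsto_mult_left[OF l_power_tendsto_0, of "P + Q"] by simp
  ultimately have "\<bar>\<phi> x - \<psi> y\<bar> \<le> 0"
    by (intro LIMSEQ_le_const) auto
  then show ?thesis
    by simp
qed

lemma coincidence_exists:
  assumes thick: "(1 - 2 * l) * P \<le> l * q" "(1 - 2 * l) * Q \<le> p"
    and ends: "\<phi> 0 \<le> \<psi> 1" "\<psi> 0 \<le> \<phi> 1"
  obtains x y where "x \<in> K" "y \<in> K" "\<phi> x = \<psi> y"
proof -
  have "\<exists>a'\<in>kids n a. \<exists>b'\<in>kids n b. linked (Suc n) a' b'"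
    if ab: "a \<in> lefts n" "b \<in> lefts n" and "linked n a b" for n a b
  proof -
    have "(1 - 2 * l) * P * l ^ n \<le> l * q * l ^ n" "(1 - 2 * l) * Q * l ^ n \<le> p * l ^ n"
      using thick l by (intro mult_right_mono; simp)+
    then have "\<psi> (b + (1 - l) * l ^ n) - \<psi> (b + l * l ^ n) \<le> \<phi> (a + l ^ n) - \<phi> a"
      "\<phi> (a + (1 - l) * l ^ n) - \<phi> (a + l * l ^ n) \<le> \<psi> (b + l * l ^ n) - \<psi> b"
      "\<phi> (a + (1 - l) * l ^ n) - \<phi> (a + l * l ^ n) \<le> \<psi> (b + l ^ n) - \<psi> (b + (1 - l) * l ^ n)"
      using cell_images[OF ab(1)] cell_images[OF ab(2)] by (simp_all add: mult.commute mult.left_commute)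
    from linked_intervals_split[OF cell_images_increasing(1-3)[OF ab(1)] cell_images_increasing(4-6)[OF ab(2)] _ _ this]
      that(3)
    have "linked (Suc n) a b \<or> linked (Suc n) a (b + (1 - l) * l ^ n) \<or> linked (Suc n) (a + (1 - l) * l ^ n) b
      \<or> linked (Suc n) (a + (1 - l) * l ^ n) (b + (1 - l) * l ^ n)"
      unfolding linked_def by (simp add: algebra_simps)
    then show ?thesis
      by (auto simp: kids_def)
  qed
  moreover have "linked 0 0 0"
    using ends by (simp add: linked_def)
  ultimately obtain x y where "x \<in> K" "y \<in> K"
    "\<And>n. \<exists>a\<in>lefts n. \<exists>b\<in>lefts n. linked n a b \<and> x \<in> cell n a \<and> y \<in> cell n b"
    using descending_cells[of linked] by blast
  with linked_limit that show ?thesis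
    by blast
qed

text \<open>
  The weight is the length of the overlap of the two images. An overlap of at least
  \<open>w * l * l ^ n\<close> loses at most \<open>(P + 2 * Q) * (1 - 2 * l) * l ^ n\<close> to the gaps, and a smaller one loses nothing,
  so each generation keeps the fraction \<open>\<beta>\<close> of the weight. Assumption \<open>loss\<close> says
  \<open>l / \<beta> \<le> l powr s\<close>, which turns the length of the images into the required decay.
\<close>

lemma coincidence_dim_overlap:
  fixes F :: "real \<times> real \<Rightarrow> 'a::metric_space"
  assumes s: "0 < s" and w: "w \<le> p" "w \<le> q" "0 < w"
    and loss: "l powr (1 - s) \<le> 1 - (P + 2 * Q) * (1 - 2 * l) / (l * w)"
    and ends: "\<phi> 0 < \<psi> 1" "\<psi> 0 < \<phi> 1"
    and \<kappa>: "0 < \<kappa>" and F: "\<And>z w. \<kappa> * dist z w \<le> dist (F z) (F w)"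
    and S: "\<And>x y. \<lbrakk>x \<in> K; y \<in> K; \<phi> x = \<psi> y\<rbrakk> \<Longrightarrow> F (x, y) \<in> S"
  shows "ereal s \<le> hausdorff_dim S"
proof -
  define \<beta> where "\<beta> = 1 - (P + 2 * Q) * (1 - 2 * l) / (l * w)"
  have \<beta>: "0 < \<beta>"
    using less_le_trans[OF _ loss, of 0] l unfolding \<beta>_def by simp
  have \<beta>1: "\<beta> \<le> 1"
    using slopes slopes_le l w unfolding \<beta>_def by auto
  define h where "h n a b = overlap (\<phi> a) (\<phi> (a + l ^ n)) (\<psi> b) (\<psi> (b + l ^ n))" for n a b
  define g where "g n a b = h n a b / \<beta> ^ n" for n a b
  have h_split: "\<beta> * h n a b \<le> (\<Sum>(a', b')\<in>kids n a \<times> kids n b. h (Suc n) a' b')"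
    if ab: "a \<in> lefts n" "b \<in> lefts n" for n a b
  proof -
    note inc = cell_images_increasing(1-3)[OF ab(1)] cell_images_increasing(4-6)[OF ab(2)]
    note im = cell_images[OF ab(1)] cell_images[OF ab(2)]
    have ends: "a + (1 - l) * l ^ n + l * l ^ n = a + l ^ n" "b + (1 - l) * l ^ n + l * l ^ n = b + l ^ n"
      by (auto simp: algebra_simps)
    let ?sum = "\<Sum>(a', b')\<in>kids n a \<times> kids n b. h (Suc n) a' b'"
    have sum: "?sum = h (Suc n) a b + h (Suc n) a (b + (1 - l) * l ^ n)
      + h (Suc n) (a + (1 - l) * l ^ n) b + h (Suc n) (a + (1 - l) * l ^ n) (b + (1 - l) * l ^ n)"
      by (rule sum_kids)
    have wl: "w * l * l ^ n \<le> p * l * l ^ n" "w * l * l ^ n \<le> q * l * l ^ n"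
      using w l by (auto intro!: mult_right_mono)
    show ?thesis
    proof (cases "h n a b < w * l * l ^ n")
      case True
      then have "h n a b \<le> ?sum"
        using overlap_cut_small[OF inc, of "w * l * l ^ n"] im wl
        unfolding sum unfolding h_def power_Suc ends by linarith
      moreover have "\<beta> * h n a b \<le> 1 * h n a b"
        using \<beta>1 overlap_nonneg unfolding h_def by (intro mult_right_mono)
      ultimately show ?thesis
        by simp
    next
      case False
      let ?X = "(P + 2 * Q) * (1 - 2 * l)"
      have "?X * l ^ n = ?X / (l * w) * (w * l * l ^ n)"
        using w l by (simp add: field_simps)
      also have "\<dots> \<le> ?X / (l * w) * h n a b"
        using False slopes slopes_le l w by (intro mult_left_mono) auto
      finally have "\<beta> * h n a b \<le> h n a b - ?X * l ^ n"
        by (simp add: \<beta>_def algebra_simps)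
      also have "\<dots> \<le> ?sum"
        using overlap_cut[OF inc] im(4) im(28)
        unfolding sum unfolding h_def power_Suc ends by (simp add: algebra_simps)
      finally show ?thesis .
    qed
  qed
  show ?thesis
  proof (rule hausdorff_dim_ge_weighted_tree[OF s \<kappa> F, where g = g and C = P])
    show "0 < g 0 0 0"
      using ends slopes cell_images(7,15)[of 0 0] by (simp add: g_def h_def overlap_def less_max_iff_disj)
    show "0 \<le> g n a b" for n a b
      using \<beta> overlap_nonneg by (simp add: g_def h_def)
  next
    fix n a b assume ab: "a \<in> lefts n" "b \<in> lefts n"
    have "g n a b = \<beta> * h n a b / \<beta> ^ Suc n"
      using \<beta> by (simp add: g_def)
    also have "\<dots> \<le> (\<Sum>(a', b')\<in>kids n a \<times> kids n b. h (Suc n) a' b') / \<beta> ^ Suc n"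
      using \<beta> by (intro divide_right_mono h_split ab) simp
    also have "\<dots> = (\<Sum>(a', b')\<in>kids n a \<times> kids n b. g (Suc n) a' b')"
      by (simp add: g_def sum_divide_distrib case_prod_beta)
    finally show "g n a b \<le> (\<Sum>(a', b')\<in>kids n a \<times> kids n b. g (Suc n) a' b')" .
  next
    fix n a b assume ab: "a \<in> lefts n" "b \<in> lefts n"
    have "l = l powr s * l powr (1 - s)"
      using l by (simp add: powr_add[symmetric])
    also have "\<dots> \<le> l powr s * \<beta>"
      using loss unfolding \<beta>_def by (intro mult_left_mono) auto
    finally have "l ^ n \<le> (l powr s * \<beta>) ^ n"
      using l by (intro power_mono) auto
    then have "l ^ n / \<beta> ^ n \<le> (l ^ n) powr s"
      using \<beta> by (simp add: powr_power power_mult_distrib field_simps)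
    moreover have "h n a b \<le> P * l ^ n"
      using cell_images(7,8)[OF ab(1)] slopes l slopes_le unfolding h_def overlap_def
      by (smt (verit) mult_nonneg_nonneg zero_less_power)
    then have "g n a b \<le> P * (l ^ n / \<beta> ^ n)"
      using \<beta> by (simp add: g_def divide_right_mono)
    ultimately show "g n a b \<le> P * (l ^ n) powr s"
      using slopes slopes_le by (smt (verit) mult_left_mono)
  next
    fix x y assume xy: "x \<in> K" "y \<in> K"
      "\<And>n. \<exists>a\<in>lefts n. \<exists>b\<in>lefts n. 0 < g n a b \<and> x \<in> cell n a \<and> y \<in> cell n b"
    have "linked n a b" if "0 < g n a b" for n a b
    proof -
      have "0 < h n a b"
        using that \<beta> by (simp add: g_def zero_less_divide_iff)
      then show ?thesis
        by (auto simp: h_def overlap_def linked_def less_max_iff_disj)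
    qed
    with xy linked_limit have "\<phi> x = \<psi> y"
      by metis
    with S xy show "F (x, y) \<in> S"
      by blast
  qed
qed

text \<open>
  Let \<open>\<mu>\<close> be the margin relative to the size of the cells, and start with \<open>\<mu> \<ge> \<delta>\<close>. If the images are not in an
  extreme position, two pairs of children have \<open>\<mu> \<ge> \<delta>\<close>, by \<open>thick\<close>. In an extreme position only one
  pair may survive, but \<open>growth\<close> ensures that its \<open>\<mu>\<close> is at least \<open>r\<close> times as large, for a fixed \<open>r > 1\<close>. In both cases the
  sum of \<open>\<mu> powr \<eta>\<close> grows by \<open>r powr \<eta>\<close> if \<open>\<eta>\<close> is small: \<open>\<mu>\<close> is at most \<open>P + Q\<close>, so it suffices that
  \<open>(r * (P + Q) / \<delta>) powr \<eta> \<le> 2\<close>.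
\<close>

lemma coincidence_dim_pos:
  fixes F :: "real \<times> real \<Rightarrow> 'a::metric_space"
  assumes thick: "(1 - 2 * l) * Q < l * p" and growth: "P * (1 - l - l\<^sup>2) < l * q"
    and ends: "\<phi> 0 < \<psi> 1" "\<psi> 0 < \<phi> 1"
    and \<kappa>: "0 < \<kappa>" and F: "\<And>z w. \<kappa> * dist z w \<le> dist (F z) (F w)"
    and S: "\<And>x y. \<lbrakk>x \<in> K; y \<in> K; \<phi> x = \<psi> y\<rbrakk> \<Longrightarrow> F (x, y) \<in> S"
  shows "0 < hausdorff_dim S"
proof -
  \<comment> \<open>The slack that remains in \<open>growth\<close> when the margin is required to grow by \<open>r\<close>.\<close>
  let ?G = "\<lambda>r. l * q - P * (r * l\<^sup>2 + (1 + r * l) * (1 - 2 * l))"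
  have "?G 1 > 0"
    using growth by (simp add: algebra_simps power2_eq_square)
  moreover have "(?G \<longlongrightarrow> ?G 1) (at_right 1)"
    by (intro tendsto_intros)
  ultimately have "\<forall>\<^sub>F r in at_right 1. 0 < ?G r"
    by (rule order_tendstoD(1)[rotated])
  moreover have "\<forall>\<^sub>F r in at_right (1::real). r < 2"
    by (rule eventually_at_right_real[of 1 2, THEN eventually_mono]) auto
  moreover have "\<forall>\<^sub>F r in at_right (1::real). 1 < r"
    by (rule eventually_at_right_less)
  ultimately have "\<forall>\<^sub>F r in at_right (1::real). 0 < ?G r \<and> r < 2 \<and> 1 < r"
    by eventually_elim auto
  then obtain r where r: "0 < ?G r" "r < 2" "1 < r"
    using eventually_happens trivial_limit_at_right_real by blast
  define \<delta> where "\<delta> = Min {(l * p - (1 - 2 * l) * Q) / 2, ?G r / 2, margin (\<phi> 0) (\<phi> 1) (\<psi> 0) (\<psi> 1)}"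
  have \<delta>: "0 < \<delta>"
    using thick r ends by (simp add: \<delta>_def margin_def)
  have \<delta>_le: "\<delta> \<le> (l * p - (1 - 2 * l) * Q) / 2" "\<delta> \<le> ?G r / 2" "\<delta> \<le> margin (\<phi> 0) (\<phi> 1) (\<psi> 0) (\<psi> 1)"
    unfolding \<delta>_def by (intro Min_le; simp)+
  define \<mu> where "\<mu> n a b = margin (\<phi> a) (\<phi> (a + l ^ n)) (\<psi> b) (\<psi> (b + l ^ n)) / l ^ n" for n a b

  have kids: "(\<exists>a'\<in>kids n a. \<exists>b'\<in>kids n b. r * \<mu> n a b \<le> \<mu> (Suc n) a' b') \<or>
      (\<exists>s\<in>kids n a \<times> kids n b. \<exists>t\<in>kids n a \<times> kids n b. s \<noteq> t \<and>
        \<delta> \<le> \<mu> (Suc n) (fst s) (snd s) \<and> \<delta> \<le> \<mu> (Suc n) (fst t) (snd t))"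
    if ab: "a \<in> lefts n" "b \<in> lefts n" and "\<delta> \<le> \<mu> n a b" for n a b
  proof -
    define e where "e = l ^ n"
    have e: "0 < e"
      using l by (simp add: e_def)
    define a1 a2 a3 b1 b2 b3 where "a1 = a + l * e" and "a2 = a + (1 - l) * e" and "a3 = a + e"
      and "b1 = b + l * e" and "b2 = b + (1 - l) * e" and "b3 = b + e"
    note defs = a1_def a2_def a3_def b1_def b2_def b3_def
    note inc = cell_images_increasing(1-3)[OF ab(1), folded e_def, folded defs]
      cell_images_increasing(4-6)[OF ab(2), folded e_def, folded defs]
    note im = cell_images(1-8)[OF ab(1), folded e_def, folded defs]
      cell_images(9-16)[OF ab(2), folded e_def, folded defs]
    have right_ends: "a + l * e = a1" "a2 + l * e = a3" "b + l * e = b1" "b2 + l * e = b3"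
      by (auto simp: defs algebra_simps)
    have \<mu>_kid: "\<mu> (Suc n) x y = margin (\<phi> x) (\<phi> (x + l * e)) (\<psi> y) (\<psi> (y + l * e)) / (l * e)" for x y
      by (simp add: \<mu>_def e_def)
    have \<mu>: "\<mu> n a b = margin (\<phi> a) (\<phi> a3) (\<psi> b) (\<psi> b3) / e"
      by (simp add: \<mu>_def e_def defs)
    have in_kids: "a \<in> kids n a" "a2 \<in> kids n a" "b \<in> kids n b" "b2 \<in> kids n b" and ne: "a \<noteq> a2" "b \<noteq> b2"
      using l e by (auto simp: kids_def defs e_def)
    define m where "m = margin (\<phi> a) (\<phi> a3) (\<psi> b) (\<psi> b3)"
    define d where "d = \<delta> * l * e"
    have m: "\<delta> * e \<le> m" "m \<le> \<psi> b3 - \<phi> a" "m \<le> \<phi> a3 - \<psi> b"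
      using that(3) e by (simp_all add: \<mu> m_def[symmetric] le_divide_eq) (simp_all add: m_def margin_def)
    have d: "0 \<le> d"
      using \<delta> l e by (simp add: d_def)
    have m_pos: "0 \<le> m"
      using m(1) mult_pos_pos[OF \<delta> e] by linarith
    define c where "c = r * l"
    have c: "0 \<le> c" "c \<le> 1"
      using r l mult_mono[of r 2 l "1/2"] by (auto simp: c_def)
    have "(1 + c) * l \<le> 2 * (1 / 2)"
      using c l by (intro mult_mono) auto
    then have "(1 + c) * l * \<delta> \<le> 1 * \<delta>"
      using \<delta> by (intro mult_right_mono) auto
    moreover have "x / 2 \<le> x" if "0 < x" for x :: real
      using that by simp
    then have "\<delta> \<le> ?G r"
      using r(1) by (intro order_trans[OF \<delta>_le(2)])
    ultimately have "(1 + c) * l * \<delta> \<le> ?G r"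
      by (simp only: mult_1)
    then have "(1 + c) * l * \<delta> * e \<le> ?G r * e"
      using e by (intro mult_right_mono) auto
    then have growth: "c * (P * l * e) + (1 + c) * (P * (1 - 2 * l) * e) + (1 + c) * d \<le> q * l * e"
      by (simp add: c_def d_def algebra_simps power2_eq_square)
    have growth: "(1 + c) * (x + y + d) \<le> x + q * l * e" if "x \<le> P * l * e" "y \<le> P * (1 - 2 * l) * e" for x y
    proof -
      have "c * x \<le> c * (P * l * e)" "(1 + c) * y \<le> (1 + c) * (P * (1 - 2 * l) * e)"
        using that c by (auto intro!: mult_left_mono)
      with growth show ?thesis
        by (simp add: algebra_simps)
    qed
    have grown: "r * \<mu> n a b \<le> \<mu> (Suc n) x y"
      if "c * m \<le> margin (\<phi> x) (\<phi> (x + l * e)) (\<psi> y) (\<psi> (y + l * e))" for x y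
      using that l e unfolding \<mu>_kid \<mu> m_def[symmetric] c_def by (simp add: field_simps)
    consider "\<psi> b3 - \<phi> a < \<phi> a2 - \<phi> a + d" | "\<phi> a3 - \<psi> b < \<phi> a3 - \<phi> a1 + d"
      | "\<phi> a2 - \<phi> a + d \<le> \<psi> b3 - \<phi> a" "\<phi> a3 - \<phi> a1 + d \<le> \<phi> a3 - \<psi> b"
      by linarith
    then show ?thesis
    proof cases
      case 1
      have "(1 + c) * (\<psi> b3 - \<phi> a) \<le> (1 + c) * ((\<phi> a1 - \<phi> a) + (\<phi> a2 - \<phi> a1) + d)"
        using 1 c by (intro mult_left_mono) auto
      also have "\<dots> \<le> (\<phi> a1 - \<phi> a) + q * l * e"
        using im by (intro growth) auto
      also have "\<dots> \<le> (\<phi> a1 - \<phi> a) + (\<psi> b3 - \<psi> b2)"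
        using im by simp
      finally have le: "(1 + c) * (\<psi> b3 - \<phi> a) \<le> (\<phi> a1 - \<phi> a) + (\<psi> b3 - \<psi> b2)" .
      have "c * m \<le> margin (\<phi> a) (\<phi> a1) (\<psi> b2) (\<psi> b3)"
        using margin_grows[OF c m_pos m(2) le] by (auto simp: margin_def)
      then have "r * \<mu> n a b \<le> \<mu> (Suc n) a b2"
        using grown[of a b2] unfolding right_ends by blast
      then show ?thesis
        using in_kids by blast
    next
      case 2
      have "(1 + c) * (\<phi> a3 - \<psi> b) \<le> (1 + c) * ((\<phi> a3 - \<phi> a2) + (\<phi> a2 - \<phi> a1) + d)"
        using 2 c by (intro mult_left_mono) auto
      also have "\<dots> \<le> (\<phi> a3 - \<phi> a2) + q * l * e"
        using im by (intro growth) auto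
      also have "\<dots> \<le> (\<phi> a3 - \<phi> a2) + (\<psi> b1 - \<psi> b)"
        using im by simp
      finally have le: "(1 + c) * (\<phi> a3 - \<psi> b) \<le> (\<phi> a3 - \<phi> a2) + (\<psi> b1 - \<psi> b)" .
      have "c * m \<le> margin (\<phi> a2) (\<phi> a3) (\<psi> b) (\<psi> b1)"
        using margin_grows[OF c m_pos m(3) le] by (auto simp: margin_def)
      then have "r * \<mu> n a b \<le> \<mu> (Suc n) a2 b"
        using grown[of a2 b] unfolding right_ends by blast
      then show ?thesis
        using in_kids by blast
    next
      case 3
      have "\<delta> * l \<le> \<delta> * 1"
        using l \<delta> by (intro mult_left_mono) auto
      then have "(Q * (1 - 2 * l) + 2 * (\<delta> * l)) * e \<le> p * l * e"
        using \<delta>_le(1) e by (intro mult_right_mono) (auto simp: algebra_simps)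
      then have "Q * (1 - 2 * l) * e + 2 * d \<le> p * l * e"
        by (simp add: d_def algebra_simps)
      then have "\<psi> b2 - \<psi> b1 + 2 * d \<le> \<phi> a1 - \<phi> a" "\<psi> b2 - \<psi> b1 + 2 * d \<le> \<phi> a3 - \<phi> a2"
        using im by linarith+
      from margin_two_kids[OF inc this 3 d] have
        "\<delta> \<le> \<mu> (Suc n) a b2 \<and> \<delta> \<le> \<mu> (Suc n) a2 b2 \<or> \<delta> \<le> \<mu> (Suc n) a2 b2 \<and> \<delta> \<le> \<mu> (Suc n) a b \<or>
         \<delta> \<le> \<mu> (Suc n) a b \<and> \<delta> \<le> \<mu> (Suc n) a2 b"
        using l e unfolding \<mu>_kid right_ends by (simp add: le_divide_eq d_def mult.assoc)
      then have "\<exists>s\<in>kids n a \<times> kids n b. \<exists>t\<in>kids n a \<times> kids n b. s \<noteq> t \<and>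
        \<delta> \<le> \<mu> (Suc n) (fst s) (snd s) \<and> \<delta> \<le> \<mu> (Suc n) (fst t) (snd t)"
      proof (elim disjE)
        assume "\<delta> \<le> \<mu> (Suc n) a b2 \<and> \<delta> \<le> \<mu> (Suc n) a2 b2"
        then show ?thesis
          using in_kids ne by (intro bexI[of _ "(a, b2)"] bexI[of _ "(a2, b2)"]) auto
      next
        assume "\<delta> \<le> \<mu> (Suc n) a2 b2 \<and> \<delta> \<le> \<mu> (Suc n) a b"
        then show ?thesis
          using in_kids ne by (intro bexI[of _ "(a2, b2)"] bexI[of _ "(a, b)"]) auto
      next
        assume "\<delta> \<le> \<mu> (Suc n) a b \<and> \<delta> \<le> \<mu> (Suc n) a2 b"
        then show ?thesis
          using in_kids ne by (intro bexI[of _ "(a, b)"] bexI[of _ "(a2, b)"]) auto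
      qed
      then show ?thesis ..
    qed
  qed
  have \<mu>_le: "\<mu> n a b \<le> P + Q" if "a \<in> lefts n" "b \<in> lefts n" for n a b
  proof -
    have "margin (\<phi> a) (\<phi> (a + l ^ n)) (\<psi> b) (\<psi> (b + l ^ n)) \<le> (P + Q) * l ^ n"
    proof -
      have "0 \<le> (P + Q) * l ^ n"
        using slopes slopes_le l by simp
      then show ?thesis
        using cell_images(8)[OF that(1)] cell_images(16)[OF that(2)]
        by (simp add: margin_def min_le_iff_disj algebra_simps) linarith
    qed
    then show ?thesis
      using l by (simp add: \<mu>_def divide_le_eq)
  qed
  \<comment> \<open>The summand 2 makes \<open>ln T\<close> positive.\<close>
  define T where "T = r * (P + Q) / \<delta> + 2"
  have T: "2 < T"
    using r slopes slopes_le \<delta> by (simp add: T_def)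
  define \<eta> where "\<eta> = ln 2 / ln T"
  have \<eta>: "0 < \<eta>"
    using T by (simp add: \<eta>_def)
  have "T powr \<eta> = 2"
    using T by (simp add: \<eta>_def powr_def)
  moreover have "(r * (P + Q) / \<delta>) powr \<eta> \<le> T powr \<eta>"
    using \<eta> r slopes slopes_le \<delta> by (intro powr_mono2) (auto simp: T_def)
  ultimately have "(r * (P + Q)) powr \<eta> / \<delta> powr \<eta> \<le> 2"
    using r slopes slopes_le \<delta> by (simp add: powr_divide)
  then have two: "(r * (P + Q)) powr \<eta> \<le> 2 * \<delta> powr \<eta>"
    using \<delta> by (simp add: divide_le_eq)
  define \<beta> where "\<beta> = r powr \<eta>"
  have \<beta>: "1 < \<beta>"
    using r \<eta> by (simp add: \<beta>_def gr_one_powr)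
  define h where "h n a b = (if \<delta> \<le> \<mu> n a b then \<mu> n a b powr \<eta> else 0)" for n a b
  have h_nonneg: "0 \<le> h n a b" for n a b
    by (simp add: h_def)
  define g where "g n a b = h n a b / \<beta> ^ n" for n a b
  define s where "s = ln \<beta> / ln (1 / l)"
  have s: "0 < s"
    using \<beta> l by (simp add: s_def)
  have l_powr_s: "l powr s = 1 / \<beta>"
    using \<beta> l by (simp add: s_def powr_def ln_div exp_minus field_simps)
  have h_split: "\<beta> * h n a b \<le> (\<Sum>(a', b')\<in>kids n a \<times> kids n b. h (Suc n) a' b')"
    if ab: "a \<in> lefts n" "b \<in> lefts n" and big: "\<delta> \<le> \<mu> n a b" for n a b
    using kids[OF that]
  proof (elim disjE bexE conjE)
    fix a' b' assume kid: "a' \<in> kids n a" "b' \<in> kids n b" and le: "r * \<mu> n a b \<le> \<mu> (Suc n) a' b'"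
    have "1 * \<mu> n a b \<le> r * \<mu> n a b"
      using r big \<delta> by (intro mult_right_mono) auto
    with le big have "\<delta> \<le> \<mu> (Suc n) a' b'"
      by simp
    have "\<beta> * h n a b = (r * \<mu> n a b) powr \<eta>"
      using big r \<delta> by (simp add: h_def \<beta>_def powr_mult)
    also have "\<dots> \<le> h (Suc n) a' b'"
      using \<open>\<delta> \<le> \<mu> (Suc n) a' b'\<close> le \<eta> r big \<delta> by (simp add: h_def powr_mono2)
    also have "\<dots> = (case (a', b') of (a', b') \<Rightarrow> h (Suc n) a' b')"
      by simp
    also have "\<dots> \<le> (\<Sum>(a', b')\<in>kids n a \<times> kids n b. h (Suc n) a' b')"
      using kid finite_kids h_nonneg by (intro member_le_sum) auto
    finally show ?thesis .
  next
    fix s t assume st: "s \<in> kids n a \<times> kids n b" "t \<in> kids n a \<times> kids n b" "s \<noteq> t"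
      "\<delta> \<le> \<mu> (Suc n) (fst s) (snd s)" "\<delta> \<le> \<mu> (Suc n) (fst t) (snd t)"
    have "\<beta> * h n a b = (r * \<mu> n a b) powr \<eta>"
      using big r \<delta> by (simp add: h_def \<beta>_def powr_mult)
    also have "\<dots> \<le> (r * (P + Q)) powr \<eta>"
      using \<eta> r big \<delta> \<mu>_le[OF ab] by (intro powr_mono2 mult_left_mono) auto
    also have "\<dots> \<le> \<delta> powr \<eta> + \<delta> powr \<eta>"
      using two by simp
    also have "\<dots> \<le> h (Suc n) (fst s) (snd s) + h (Suc n) (fst t) (snd t)"
      using st \<delta> \<eta> by (intro add_mono) (auto simp: h_def intro!: powr_mono2)
    also have "\<dots> = (\<Sum>(a', b')\<in>{s, t}. h (Suc n) a' b')"
      using \<open>s \<noteq> t\<close> by (simp add: case_prod_beta)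
    also have "\<dots> \<le> (\<Sum>(a', b')\<in>kids n a \<times> kids n b. h (Suc n) a' b')"
      using st finite_kids h_nonneg by (intro sum_mono2) (auto simp del: mem_Sigma_iff)
    finally show ?thesis .
  qed
  have "ereal s \<le> hausdorff_dim S"
  proof (rule hausdorff_dim_ge_weighted_tree[OF s \<kappa> F, where g = g and C = "(P + Q) powr \<eta>"])
    show "0 < g 0 0 0"
      using \<delta>_le(3) \<delta> by (simp add: g_def h_def \<mu>_def)
    show "0 \<le> g n a b" for n a b
      using \<beta> h_nonneg by (simp add: g_def)
  next
    fix n a b assume ab: "a \<in> lefts n" "b \<in> lefts n" and pos: "0 < g n a b"
    then have big: "\<delta> \<le> \<mu> n a b"
      by (auto simp: g_def h_def split: if_splits)
    have "g n a b = \<beta> * h n a b / \<beta> ^ Suc n"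
      using \<beta> by (simp add: g_def)
    also have "\<dots> \<le> (\<Sum>(a', b')\<in>kids n a \<times> kids n b. h (Suc n) a' b') / \<beta> ^ Suc n"
      using \<beta> by (intro divide_right_mono h_split ab big) simp
    also have "\<dots> = (\<Sum>(a', b')\<in>kids n a \<times> kids n b. g (Suc n) a' b')"
      by (simp add: g_def sum_divide_distrib case_prod_beta)
    finally show "g n a b \<le> (\<Sum>(a', b')\<in>kids n a \<times> kids n b. g (Suc n) a' b')" .
  next
    fix n a b assume ab: "a \<in> lefts n" "b \<in> lefts n"
    have "h n a b \<le> (P + Q) powr \<eta>"
      using \<mu>_le[OF ab] \<delta> \<eta> by (auto simp: h_def intro!: powr_mono2)
    then show "g n a b \<le> (P + Q) powr \<eta> * (l ^ n) powr s"
      using \<beta> by (simp add: powr_power l_powr_s g_def power_one_over divide_right_mono)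
  next
    fix x y assume xy: "x \<in> K" "y \<in> K"
      "\<And>n. \<exists>a\<in>lefts n. \<exists>b\<in>lefts n. 0 < g n a b \<and> x \<in> cell n a \<and> y \<in> cell n b"
    have "linked n a b" if "0 < g n a b" for n a b
    proof -
      have "0 < \<mu> n a b"
        using that \<delta> by (auto simp: g_def h_def split: if_splits)
      then show ?thesis
        using l by (simp add: \<mu>_def linked_def margin_def zero_less_divide_iff)
    qed
    with xy linked_limit have "\<phi> x = \<psi> y"
      by metis
    with S xy show "F (x, y) \<in> S"
      by blast
  qed
  with s show ?thesis
    by (metis ereal_less(2) less_le_trans)
qed

end

section \<open>The Cantor set on the circle\<close>

lemma lipschitz_circle:
  fixes u v :: real
  shows "dist (cos (2 * pi * u), sin (2 * pi * u)) (cos (2 * pi * v), sin (2 * pi * v)) \<le> 4 * pi * \<bar>u - v\<bar>"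
proof -
  have half: "2 * (\<bar>z\<bar> * \<bar>sin ((x - y) / 2)\<bar>) \<le> \<bar>x - y\<bar>" if "\<bar>z\<bar> \<le> 1" for x y z :: real
  proof -
    have "\<bar>z\<bar> * \<bar>sin ((x - y) / 2)\<bar> \<le> 1 * \<bar>(x - y) / 2\<bar>"
      by (intro mult_mono abs_sin_x_le_abs_x that) auto
    then show ?thesis
      by simp
  qed
  have "\<bar>cos x - cos y\<bar> = 2 * (\<bar>sin ((x + y) / 2)\<bar> * \<bar>sin ((y - x) / 2)\<bar>)" for x y :: real
    by (simp add: cos_diff_cos abs_mult)
  then have cos: "\<bar>cos x - cos y\<bar> \<le> \<bar>x - y\<bar>" for x y :: real
    using half[of "sin ((x + y) / 2)" y x] by (simp add: abs_minus_commute)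
  have "\<bar>sin x - sin y\<bar> = 2 * (\<bar>cos ((x + y) / 2)\<bar> * \<bar>sin ((x - y) / 2)\<bar>)" for x y :: real
    by (simp add: sin_diff_sin abs_mult)
  then have sin: "\<bar>sin x - sin y\<bar> \<le> \<bar>x - y\<bar>" for x y :: real
    using half[of "cos ((x + y) / 2)" x y] by simp
  have "\<bar>2 * pi * u - 2 * pi * v\<bar> = 2 * pi * \<bar>u - v\<bar>"
    by (simp add: right_diff_distrib[symmetric] abs_mult)
  then have "\<bar>cos (2 * pi * u) - cos (2 * pi * v)\<bar> + \<bar>sin (2 * pi * u) - sin (2 * pi * v)\<bar> \<le> 4 * pi * \<bar>u - v\<bar>"
    using cos[of "2 * pi * u" "2 * pi * v"] sin[of "2 * pi * u" "2 * pi * v"] by linarith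
  moreover have "dist (cos (2 * pi * u), sin (2 * pi * u)) (cos (2 * pi * v), sin (2 * pi * v))
      \<le> \<bar>cos (2 * pi * u) - cos (2 * pi * v)\<bar> + \<bar>sin (2 * pi * u) - sin (2 * pi * v)\<bar>"
    using sqrt_sum_squares_le_sum_abs by (simp add: dist_prod_def dist_real_def)
  ultimately show ?thesis
    by linarith
qed

lemma hausdorff_dim_circle_le:
  assumes "A \<subseteq> unit_circle"
  shows "hausdorff_dim A \<le> 1"
proof (rule hausdorff_dim_lipschitz_curve[OF lipschitz_circle])
  show "A \<subseteq> (\<lambda>t. (cos (2 * pi * t), sin (2 * pi * t))) ` {0..1}"
  proof
    fix z assume "z \<in> A"
    then have "(fst z)\<^sup>2 + (snd z)\<^sup>2 = 1"
      using assms by (auto simp: unit_circle_def)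
    then obtain t where t: "0 \<le> t" "t < 2 * pi" "fst z = cos t" "snd z = sin t"
      by (rule sincos_total_2pi) auto
    then have "z = (cos (2 * pi * (t / (2 * pi))), sin (2 * pi * (t / (2 * pi))))"
      by (simp add: prod_eq_iff)
    moreover have "t / (2 * pi) \<in> {0..1}"
      using t by simp
    ultimately show "z \<in> (\<lambda>t. (cos (2 * pi * t), sin (2 * pi * t))) ` {0..1}"
      by (rule image_eqI)
  qed
qed

context cantor_ratio
begin

abbreviation E :: "(real \<times> real) set" where
  "E \<equiv> cantor_circle l"

lemma E_swap: "prod.swap z \<in> E \<longleftrightarrow> z \<in> E"
  by (cases z) (auto simp: cantor_circle_def unit_circle_def add.commute)

lemma E_compact: "compact E"
proof -
  have "unit_circle = {z. (fst z)\<^sup>2 + (snd z)\<^sup>2 = 1}"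
    by (auto simp: unit_circle_def)
  moreover have "closed {z :: real \<times> real. (fst z)\<^sup>2 + (snd z)\<^sup>2 = 1}"
    by (intro closed_Collect_eq continuous_intros)
  ultimately show ?thesis
    unfolding cantor_circle_def using cantor_set_props(1)[OF l]
    by (intro compact_Int_closed compact_Times) auto
qed

lemma E_lepoll_reals: "E \<lesssim> (UNIV :: real set)"
proof -
  have "inj_on fst E"
  proof (rule inj_onI)
    fix z w assume zw: "z \<in> E" "w \<in> E" "fst z = fst w"
    then have "snd z \<in> K" "snd w \<in> K" "(fst z)\<^sup>2 + (snd z)\<^sup>2 = 1" "(fst w)\<^sup>2 + (snd w)\<^sup>2 = 1"
      by (simp_all add: cantor_circle_def unit_circle_def mem_Times_iff case_prod_beta)
    then have "0 \<le> snd z" "0 \<le> snd w" "(snd z)\<^sup>2 = (snd w)\<^sup>2"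
      using cantor_set_props(4)[OF l] zw(3) by (force, force, simp)
    then have "snd z = snd w"
      by (simp add: power2_eq_iff_nonneg)
    with zw(3) show "z = w"
      by (simp add: prod_eq_iff)
  qed
  then show ?thesis
    unfolding lepoll_def by blast
qed

lemma E_continuum:
  assumes "0 < hausdorff_dim E"
  shows "E \<approx> (UNIV :: real set)"
proof -
  have "uncountable E"
    using assms hausdorff_dim_countable[of E] by (meson less_le_not_le)
  then show ?thesis
    by (rule lepoll_antisym[OF E_lepoll_reals uncountable_compact_continuum[OF E_compact]])
qed

text \<open>
  The part of the circle over one pair of Cantor intervals of length \<open>r\<close>, with left ends \<open>a\<close> and \<open>c\<close>, in the
  coordinates scaled by \<open>l ^ N\<close> and \<open>l ^ (2 * N)\<close> around the pole \<open>(0, 1)\<close>. The circle is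
  \<open>chart_fst a r x = chart_snd e c r y\<close>; division by \<open>r\<close> makes the slopes independent of the level.
\<close>

definition chart :: "nat \<Rightarrow> real \<Rightarrow> real \<Rightarrow> real \<Rightarrow> real \<times> real \<Rightarrow> real \<times> real" where
  "chart N a c r z = (l ^ N * (a + r * fst z), 1 - (l ^ N)\<^sup>2 * (c + r * snd z))"

definition chart_fst :: "real \<Rightarrow> real \<Rightarrow> real \<Rightarrow> real" where
  "chart_fst a r x = (a + r * x)\<^sup>2 / (2 * r)"

definition chart_snd :: "real \<Rightarrow> real \<Rightarrow> real \<Rightarrow> real \<Rightarrow> real" where
  "chart_snd e c r y = ((c + r * y) - e * (c + r * y)\<^sup>2 / 2) / r"

lemma chart_in_E:
  assumes "a + r * x \<in> K" "c + r * y \<in> K" and r: "0 < r"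
    and eq: "chart_fst a r x = chart_snd ((l ^ N)\<^sup>2) c r y"
  shows "chart N a c r (x, y) \<in> E"
proof -
  define X Y e where "X = a + r * x" and "Y = c + r * y" and "e = (l ^ N)\<^sup>2"
  have "X\<^sup>2 = 2 * Y - e * Y\<^sup>2"
    using eq r unfolding chart_fst_def chart_snd_def X_def[symmetric] Y_def[symmetric] e_def[symmetric]
    by (simp add: field_simps)
  then have "e * X\<^sup>2 = e * (2 * Y - e * Y\<^sup>2)"
    by simp
  then have "e * X\<^sup>2 + (1 - e * Y)\<^sup>2 = 1"
    by (simp add: power2_eq_square algebra_simps)
  then have "(l ^ N * X)\<^sup>2 + (1 - e * Y)\<^sup>2 = 1"
    by (simp add: e_def power_mult_distrib)
  moreover have "l ^ N * X \<in> K" "1 - e * Y \<in> K"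
    using assms(1,2) K_left_power[of X N] K_mirror[OF K_left_power[of Y "N * 2"]]
    by (auto simp: X_def Y_def e_def power_mult)
  ultimately show ?thesis
    by (simp add: chart_def cantor_circle_def unit_circle_def X_def Y_def e_def)
qed

lemma chart_expands:
  assumes "0 < r"
  shows "(l ^ N)\<^sup>2 * r * dist z w \<le> dist (chart N a c r z) (chart N a c r w)"
proof -
  define k where "k = l ^ N"
  have k: "0 < k" "k \<le> 1"
    using l by (auto simp: k_def power_le_one)
  define dx dy where "dx = fst z - fst w" and "dy = snd z - snd w"
  have "k\<^sup>2 \<le> k"
    using k by (simp add: power2_eq_square mult_left_le)
  then have "(k\<^sup>2)\<^sup>2 \<le> k\<^sup>2"
    using k by (intro power_mono) auto
  then have "(k\<^sup>2)\<^sup>2 * (r\<^sup>2 * dx\<^sup>2) \<le> k\<^sup>2 * (r\<^sup>2 * dx\<^sup>2)"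
    by (intro mult_right_mono) auto
  then have "(k\<^sup>2 * r)\<^sup>2 * (dx\<^sup>2 + dy\<^sup>2) \<le> (k * r * dx)\<^sup>2 + (k\<^sup>2 * r * dy)\<^sup>2"
    by (simp add: power_mult_distrib algebra_simps)
  then have "sqrt ((k\<^sup>2 * r)\<^sup>2 * (dx\<^sup>2 + dy\<^sup>2)) \<le> sqrt ((k * r * dx)\<^sup>2 + (k\<^sup>2 * r * dy)\<^sup>2)"
    by (rule real_sqrt_le_mono)
  moreover have "sqrt ((k\<^sup>2 * r)\<^sup>2 * (dx\<^sup>2 + dy\<^sup>2)) = k\<^sup>2 * r * dist z w"
    using assms by (simp add: real_sqrt_mult dist_prod_def dist_real_def dx_def dy_def)
  moreover have "sqrt ((k * r * dx)\<^sup>2 + (k\<^sup>2 * r * dy)\<^sup>2) = dist (chart N a c r z) (chart N a c r w)"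
  proof -
    have "k * (a + r * fst z) - k * (a + r * fst w) = k * r * dx"
      "1 - k\<^sup>2 * (c + r * snd z) - (1 - k\<^sup>2 * (c + r * snd w)) = - (k\<^sup>2 * r * dy)"
      by (auto simp: dx_def dy_def algebra_simps)
    then show ?thesis
      by (simp add: chart_def dist_prod_def dist_real_def k_def)
  qed
  ultimately show ?thesis
    unfolding k_def by linarith
qed

lemma chart_increasing_pair:
  assumes "0 < a" "0 < r" "0 \<le> c" "0 \<le> e" "e * (c + r) < 1"
  shows "increasing_pair l (chart_fst a r) (chart_snd e c r) a (a + r) (1 - e * (c + r)) 1"
proof unfold_locales
  fix x y :: real assume xy: "0 \<le> x" "x \<le> y" "y \<le> 1"
  have sum: "0 \<le> r * (x + y) / 2" "r * (x + y) / 2 \<le> r"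
    using xy assms mult_left_mono[of "x + y" 2 r] by auto
  have "chart_fst a r y - chart_fst a r x = (a + r * (x + y) / 2) * (y - x)"
    using assms by (simp add: chart_fst_def power2_eq_square field_simps)
  moreover have "a * (y - x) \<le> (a + r * (x + y) / 2) * (y - x)" "(a + r * (x + y) / 2) * (y - x) \<le> (a + r) * (y - x)"
    using xy sum by (intro mult_right_mono; simp)+
  ultimately show "a * (y - x) \<le> chart_fst a r y - chart_fst a r x \<and> chart_fst a r y - chart_fst a r x \<le> (a + r) * (y - x)"
    by simp
  have "chart_snd e c r y - chart_snd e c r x = (1 - e * (c + r * (x + y) / 2)) * (y - x)"
    using assms by (simp add: chart_snd_def power2_eq_square field_simps)
  moreover have "e * (c + r * (x + y) / 2) \<le> e * (c + r)" "0 \<le> e * (c + r * (x + y) / 2)"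
    using assms sum by (auto intro!: mult_left_mono mult_nonneg_nonneg)
  then have "(1 - e * (c + r)) * (y - x) \<le> (1 - e * (c + r * (x + y) / 2)) * (y - x)"
    "(1 - e * (c + r * (x + y) / 2)) * (y - x) \<le> 1 * (y - x)"
    using xy by (intro mult_right_mono; linarith)+
  ultimately show "(1 - e * (c + r)) * (y - x) \<le> chart_snd e c r y - chart_snd e c r x \<and>
      chart_snd e c r y - chart_snd e c r x \<le> 1 * (y - x)"
    by simp
qed (use assms in auto)

lemma chart_ends:
  assumes "0 < r"
  shows "chart_fst a r 0 \<le> chart_snd e c r 1 \<longleftrightarrow> a\<^sup>2 + e * (c + r)\<^sup>2 \<le> 2 * (c + r)"
    and "chart_fst a r 0 < chart_snd e c r 1 \<longleftrightarrow> a\<^sup>2 + e * (c + r)\<^sup>2 < 2 * (c + r)"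
    and "chart_snd e c r 0 \<le> chart_fst a r 1 \<longleftrightarrow> 2 * c \<le> (a + r)\<^sup>2 + e * c\<^sup>2"
    and "chart_snd e c r 0 < chart_fst a r 1 \<longleftrightarrow> 2 * c < (a + r)\<^sup>2 + e * c\<^sup>2"
proof -
  have "chart_fst a r 0 = a\<^sup>2 / (2 * r)" "chart_snd e c r 1 = (2 * (c + r) - e * (c + r)\<^sup>2) / (2 * r)"
    "chart_fst a r 1 = (a + r)\<^sup>2 / (2 * r)" "chart_snd e c r 0 = (2 * c - e * c\<^sup>2) / (2 * r)"
    using assms by (simp_all add: chart_fst_def chart_snd_def field_simps)
  then show "chart_fst a r 0 \<le> chart_snd e c r 1 \<longleftrightarrow> a\<^sup>2 + e * (c + r)\<^sup>2 \<le> 2 * (c + r)"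
    "chart_fst a r 0 < chart_snd e c r 1 \<longleftrightarrow> a\<^sup>2 + e * (c + r)\<^sup>2 < 2 * (c + r)"
    "chart_snd e c r 0 \<le> chart_fst a r 1 \<longleftrightarrow> 2 * c \<le> (a + r)\<^sup>2 + e * c\<^sup>2"
    "chart_snd e c r 0 < chart_fst a r 1 \<longleftrightarrow> 2 * c < (a + r)\<^sup>2 + e * c\<^sup>2"
    using assms by (auto simp: divide_le_cancel divide_less_cancel)
qed

lemma scale_tendsto_0: "(\<lambda>N. (l ^ N)\<^sup>2) \<longlonglongrightarrow> 0"
  using tendsto_power[OF l_power_tendsto_0, of 2] by simp

text \<open>
  Strict inequalities that hold for \<open>e = 0\<close>, in the limit at the pole, hold for \<open>e = l ^ (2 * N)\<close> with large \<open>N\<close>.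
\<close>

lemma small_scale:
  fixes f :: "real \<Rightarrow> real"
  assumes "f 0 < d" "continuous_on UNIV f"
  shows "\<forall>\<^sub>F N in sequentially. f ((l ^ N)\<^sup>2) < d"
proof -
  have "(\<lambda>N. f ((l ^ N)\<^sup>2)) \<longlonglongrightarrow> f 0"
    using continuous_on_tendsto_compose[OF assms(2) scale_tendsto_0] by simp
  then show ?thesis
    using assms(1) by (rule order_tendstoD)
qed

lemma square_le_chord:
  assumes "3 / 10 < l"
  shows "20 * l\<^sup>2 \<le> 16 * l - 3"
proof -
  have "0 \<le> (1 - 2 * l) * (10 * l - 3)"
    using l assms by simp
  then show ?thesis
    by (simp add: power2_eq_square algebra_simps)
qed

text \<open>
  The intervals are \<open>{1 - l..1 - l + l\<^sup>2}\<close> for \<open>a\<close> and \<open>{l - l\<^sup>2..l}\<close> for \<open>c\<close>. In the limit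
  \<open>e \<rightarrow> 0\<close> the images of these meet, because \<open>(1 - l)\<^sup>2 < 2 * l\<close> and \<open>2 * (l - l\<^sup>2) \<le> (1 - l + l\<^sup>2)\<^sup>2\<close>, and the slope of \<open>\<phi>\<close> is at most
  \<open>1 - l + l\<^sup>2\<close>. Each large \<open>N\<close> contributes one point, and these are distinct since the first
  coordinates decrease.
\<close>

lemma sequence_to_pole:
  assumes cubic: "0 < 2 * l ^ 3 - 3 * l\<^sup>2 + 4 * l - 1" and l3: "3 / 10 < l"
  obtains p where "inj p" "range p \<subseteq> E" "p \<longlonglongrightarrow> (0, 1)"
proof -
  let ?a = "1 - l" and ?c = "l - l\<^sup>2" and ?r = "l\<^sup>2"
  have sq: "0 < l\<^sup>2" "l\<^sup>2 < l / 2" "l\<^sup>2 \<le> l"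
    using l by (auto simp: power2_eq_square)
  have "\<forall>\<^sub>F N in sequentially. (l ^ N)\<^sup>2 * l + ((1 - 2 * l) * (?a + ?r) / l) < 1"
  proof (rule small_scale)
    show "0 * l + ((1 - 2 * l) * (?a + ?r) / l) < 1"
      using cubic l by (simp add: field_simps power2_eq_square power3_eq_cube)
  qed (intro continuous_intros)
  moreover have "\<forall>\<^sub>F N in sequentially. (l ^ N)\<^sup>2 * l\<^sup>2 + (1 - l)\<^sup>2 < 2 * l"
  proof (rule small_scale)
    show "0 * l\<^sup>2 + (1 - l)\<^sup>2 < 2 * l"
      using l3 square_le_chord[OF l3] by (simp add: power2_eq_square algebra_simps)
  qed (intro continuous_intros)
  ultimately have "\<forall>\<^sub>F N in sequentially. \<exists>x\<in>K. \<exists>y\<in>K. chart N ?a ?c ?r (x, y) \<in> E"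
  proof eventually_elim
    case (elim N)
    define e where "e = (l ^ N)\<^sup>2"
    have e: "0 \<le> e" "e * l < 1"
    proof -
      have "0 \<le> (1 - 2 * l) * (?a + ?r) / l"
        using l sq by (intro divide_nonneg_nonneg mult_nonneg_nonneg) linarith+
      then show "0 \<le> e" "e * l < 1"
        using elim(1) unfolding e_def by (simp, linarith)
    qed
    interpret increasing_pair l "chart_fst ?a ?r" "chart_snd e ?c ?r" ?a "?a + ?r" "1 - e * (?c + ?r)" 1
      using l sq e by (intro chart_increasing_pair) auto
    have cr: "?c + ?r = l"
      by simp
    obtain x y where xy: "x \<in> K" "y \<in> K" "chart_fst ?a ?r x = chart_snd e ?c ?r y"
    proof (rule coincidence_exists)
      show "(1 - 2 * l) * (?a + ?r) \<le> l * (1 - e * (?c + ?r))"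
        using elim(1) l unfolding e_def[symmetric] cr by (simp add: field_simps)
      show "(1 - 2 * l) * 1 \<le> 1 - l"
        using l by simp
      show "chart_fst ?a ?r 0 \<le> chart_snd e ?c ?r 1"
        using elim(2) unfolding chart_ends(1)[OF sq(1)] e_def cr by simp
      have "2 * t \<le> (1 - t)\<^sup>2" if "t \<le> 1 / 4" for t :: real
      proof -
        have "0 \<le> (1 - 4 * t) * (15 - 4 * t)"
          using that by simp
        then show ?thesis
          by (simp add: power2_eq_square algebra_simps)
      qed
      moreover have "?c \<le> 1 / 4"
        using zero_le_square[of "l - 1 / 2"] by (simp add: power2_eq_square algebra_simps)
      ultimately have "2 * ?c \<le> (1 - ?c)\<^sup>2"
        by blast
      also have "1 - ?c = ?a + ?r"
        by simp
      finally have "2 * ?c \<le> (?a + ?r)\<^sup>2" .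
      moreover have "0 \<le> e * ?c\<^sup>2"
        using e by simp
      ultimately show "chart_snd e ?c ?r 0 \<le> chart_fst ?a ?r 1"
        unfolding chart_ends(3)[OF sq(1)] by linarith
    qed auto
    moreover have "?a + ?r * x \<in> K" "?c + ?r * y \<in> K"
      using K_right[OF K_left[OF xy(1)]] K_left[OF K_right[OF xy(2)]]
      by (auto simp: power2_eq_square algebra_simps)
    ultimately show ?case
      using chart_in_E sq by (metis e_def)
  qed
  then obtain M where M: "\<And>N. N \<ge> M \<Longrightarrow> \<exists>x\<in>K. \<exists>y\<in>K. chart N ?a ?c ?r (x, y) \<in> E"
    by (auto simp: eventually_sequentially)
  then have "\<exists>x y. x \<in> K \<and> y \<in> K \<and> chart (M + n) ?a ?c ?r (x, y) \<in> E" for n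
    using M[of "M + n", OF le_add1] by blast
  then obtain x y where xy: "\<And>n. x n \<in> K" "\<And>n. y n \<in> K" "\<And>n. chart (M + n) ?a ?c ?r (x n, y n) \<in> E"
    by metis
  define p where "p n = chart (M + n) ?a ?c ?r (x n, y n)" for n
  have unit: "0 \<le> x n" "x n \<le> 1" "0 \<le> y n" "y n \<le> 1" for n
    using xy(1,2)[of n] cantor_set_props(4)[OF l] by auto
  have bounds: "?a \<le> ?a + ?r * x n" "?a + ?r * x n \<le> ?a + ?r" "0 \<le> ?c + ?r * y n" "?c + ?r * y n \<le> 1" for n
  proof -
    have "0 \<le> ?r * x n" "?r * x n \<le> ?r" "0 \<le> ?r * y n" "?r * y n \<le> ?r"
      using unit[of n] by (simp_all add: mult_left_le)
    then show "?a \<le> ?a + ?r * x n" "?a + ?r * x n \<le> ?a + ?r" "0 \<le> ?c + ?r * y n" "?c + ?r * y n \<le> 1"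
      using sq l by linarith+
  qed
  have dec: "fst (p (Suc n)) < fst (p n)" for n
  proof -
    have "l * (?a + ?r * x (Suc n)) \<le> l * (?a + ?r)"
      using bounds l by (intro mult_left_mono) auto
    also have "l * (?a + ?r) < ?a"
    proof -
      have "l * l\<^sup>2 < 1 * l\<^sup>2"
        using l sq by (intro mult_strict_right_mono) auto
      moreover have "l * (?a + ?r) = l - l\<^sup>2 + l * l\<^sup>2"
        by (simp add: algebra_simps power2_eq_square)
      ultimately show ?thesis
        using l by linarith
    qed
    also have "?a \<le> ?a + ?r * x n"
      by (rule bounds)
    finally have "l ^ (M + n) * (l * (?a + ?r * x (Suc n))) < l ^ (M + n) * (?a + ?r * x n)"
      using l by (intro mult_strict_left_mono) auto
    then show ?thesis
      by (simp add: p_def chart_def mult.assoc mult.left_commute)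
  qed
  have "inj (\<lambda>n. - fst (p n))"
    using dec by (intro strict_mono_imp_inj_on strict_monoI_Suc) simp
  then have "inj p"
    unfolding inj_on_def by (metis)
  moreover have "range p \<subseteq> E"
    using xy(3) by (auto simp: p_def)
  moreover have "p \<longlonglongrightarrow> (0, 1)"
  proof -
    have lim: "(\<lambda>n. l ^ (M + n)) \<longlonglongrightarrow> 0"
      using LIMSEQ_ignore_initial_segment[OF l_power_tendsto_0, of M] by (simp add: add.commute)
    have pos: "0 \<le> l ^ (M + n)" "0 \<le> ?a + ?r * x n" "?a + ?r * x n \<le> 1" for n
      using l bounds(1,2)[of n] sq(3) by (simp, linarith+)
    have "(\<lambda>n. l ^ (M + n) * (?a + ?r * x n)) \<longlonglongrightarrow> 0"
    proof (rule tendsto_sandwich[OF _ _ tendsto_const lim])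
      show "\<forall>\<^sub>F n in sequentially. 0 \<le> l ^ (M + n) * (?a + ?r * x n)"
        using pos by (intro always_eventually allI mult_nonneg_nonneg)
      show "\<forall>\<^sub>F n in sequentially. l ^ (M + n) * (?a + ?r * x n) \<le> l ^ (M + n)"
        using pos by (intro always_eventually allI mult_left_le)
    qed
    moreover have "(\<lambda>n. (l ^ (M + n))\<^sup>2 * (?c + ?r * y n)) \<longlonglongrightarrow> 0"
    proof (rule tendsto_sandwich[OF _ _ tendsto_const])
      show "(\<lambda>n. (l ^ (M + n))\<^sup>2) \<longlonglongrightarrow> 0"
        using tendsto_power[OF lim, of 2] by simp
      show "\<forall>\<^sub>F n in sequentially. 0 \<le> (l ^ (M + n))\<^sup>2 * (?c + ?r * y n)"
        using bounds(3) by (intro always_eventually allI mult_nonneg_nonneg) auto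
      show "\<forall>\<^sub>F n in sequentially. (l ^ (M + n))\<^sup>2 * (?c + ?r * y n) \<le> (l ^ (M + n))\<^sup>2"
        using bounds(4) by (intro always_eventually allI mult_left_le) auto
    qed
    then have "(\<lambda>n. 1 - (l ^ (M + n))\<^sup>2 * (?c + ?r * y n)) \<longlonglongrightarrow> 1 - 0"
      by (intro tendsto_intros)
    ultimately show ?thesis
      unfolding p_def chart_def using tendsto_Pair by fastforce
  qed
  ultimately show ?thesis
    by (rule that)
qed

text \<open>
  The point \<open>1 / (1 + l)\<close> of \<open>K\<close> has the periodic address right, left, right, left, and so on; \<open>l / (1 + l)\<close> is its mirror
  image. Of the intervals around these points those of odd level are used, with \<open>r = l ^ (2 * n + 1)\<close>:
  the left ends are \<open>a\<close> and \<open>c\<close> below. For \<open>l = lambda_star\<close> the point pair itself solves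
  \<open>a\<^sup>2 = 2 * c\<close>, and for greater \<open>l\<close> the equation is violated by an amount proportional to
  \<open>q0 = 2 * l\<^sup>2 + 2 * l - 1\<close>. The window of slopes extends to both sides by amounts of the order of \<open>q0\<close>. So \<open>r\<close> is taken
  comparable to \<open>q0\<close>: \<open>r \<le> 2 * q0\<close> puts the interval into the window, and
  \<open>r > q0 / (4 + 2 * l)\<close> makes the images meet. This range spans a factor \<open>8 + 4 * l\<close>, which exceeds the
  ratio \<open>1 / l\<^sup>2\<close> of successive choices of \<open>r\<close>.
\<close>

lemma E_dim_pos:
  assumes q: "0 < 2 * l\<^sup>2 + 2 * l - 1" and l3: "36 / 100 < l"
  shows "0 < hausdorff_dim E"
proof -
  define q0 where "q0 = 2 * l\<^sup>2 + 2 * l - 1"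
  have q0: "0 < q0" "2 * (l + l\<^sup>2) = 1 + q0"
    using q by (auto simp: q0_def)
  have sq: "0 < l\<^sup>2" "l\<^sup>2 < l / 2" "l\<^sup>2 < 1 / 4"
    using l mult_strict_mono[of l "1/2" l "1/2"] by (auto simp: power2_eq_square)
  have q01: "q0 < 1 / 2"
    using sq l by (simp add: q0_def)
  obtain n where n: "l ^ (2 * n + 1) \<le> 2 * q0" "q0 < l ^ (2 * n + 1) * (4 + 2 * l)"
  proof -
    obtain m where "l ^ m < 2 * q0"
      using real_arch_pow_inv[of "2 * q0" l] q0 l by auto
    moreover have "l ^ (2 * m + 1) \<le> l ^ m"
      using l by (intro power_decreasing) auto
    ultimately have ex: "l ^ (2 * m + 1) \<le> 2 * q0"
      by linarith
    define n where "n = (LEAST n. l ^ (2 * n + 1) \<le> 2 * q0)"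
    have n: "l ^ (2 * n + 1) \<le> 2 * q0"
      unfolding n_def using ex by (rule LeastI)
    moreover have "q0 < l ^ (2 * n + 1) * (4 + 2 * l)"
    proof (cases n)
      case 0
      then show ?thesis
        using l by (simp add: q0_def power2_eq_square algebra_simps)
    next
      case (Suc k)
      then have "2 * q0 < l ^ (2 * k + 1)"
        using not_less_Least[of k "\<lambda>n. l ^ (2 * n + 1) \<le> 2 * q0"] unfolding n_def[symmetric] by simp
      moreover have "0 < 4 + 2 * l"
        using l(1) by linarith
      ultimately have "(2 * q0) * (l\<^sup>2 * (4 + 2 * l)) < l ^ (2 * k + 1) * (l\<^sup>2 * (4 + 2 * l))"
        using sq(1) by (intro mult_strict_right_mono mult_pos_pos)
      also have "\<dots> = l ^ (2 * n + 1) * (4 + 2 * l)"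
        by (simp add: Suc power_add power2_eq_square mult_ac)
      finally have "(2 * q0) * (l\<^sup>2 * (4 + 2 * l)) < l ^ (2 * n + 1) * (4 + 2 * l)" .
      moreover have "1 / 2 \<le> l\<^sup>2 * (4 + 2 * l)"
      proof -
        have "(36/100)\<^sup>2 \<le> l\<^sup>2"
          using l3 by (intro power_mono) auto
        then have "1/8 * 4 \<le> l\<^sup>2 * (4 + 2 * l)"
          using l by (intro mult_mono) (auto simp: power2_eq_square)
        then show ?thesis
          by simp
      qed
      then have "(2 * q0) * (1/2) \<le> (2 * q0) * (l\<^sup>2 * (4 + 2 * l))"
        using q0 by (intro mult_left_mono) auto
      ultimately show ?thesis
        by simp
    qed
    ultimately show ?thesis
      by (rule that)
  qed
  define r where "r = l ^ (2 * n + 1)"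
  have r: "0 < r" "r \<le> l" "r \<le> 2 * q0" "q0 < r * (4 + 2 * l)"
    using l n power_decreasing[of 1 "2 * n + 1" l] by (auto simp: r_def)
  define a c where "a = (1 - l * r) / (1 + l)" and "c = (l - r) / (1 + l)"
  have lr: "0 < l * r" "l * r \<le> r / 2"
    using l r by auto
  have a: "0 < a" and c: "0 \<le> c" and ar: "a + r = (1 + r) / (1 + l)" and cr: "c + r = l * (1 + r) / (1 + l)"
    using l r lr by (auto simp: a_def c_def field_simps)
  have in_K: "a + r * x \<in> K \<and> c + r * y \<in> K" if xy: "x \<in> K" "y \<in> K" for x y
    unfolding a_def c_def r_def
  proof (induction n)
    case 0
    have "(1 - l * l) / (1 + l) = 1 - l"
      using l by (simp add: field_simps)
    then show ?case
      using K_right[OF xy(1)] K_left[OF xy(2)] by simp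
  next
    case (Suc n)
    define t where "t = l ^ (2 * n + 1)"
    have t: "l ^ (2 * Suc n + 1) = l * l * t"
      by (simp add: t_def)
    have "(1 - l * (l * l * t)) / (1 + l) + l * l * t * x = 1 - l + l * (l * ((1 - l * t) / (1 + l) + t * x))"
      "(l - l * l * t) / (1 + l) + l * l * t * y = l * (1 - l + l * ((l - t) / (1 + l) + t * y))"
      using l by (simp_all add: field_simps)
    then show ?case
      using Suc.IH K_left K_right unfolding t t_def[symmetric] by metis
  qed
  have "(1 - l * r)\<^sup>2 \<le> 1\<^sup>2"
    using lr r(2) l by (intro power_mono; linarith)
  also have "1\<^sup>2 < (1 + q0) * (1 + r)"
    using q0 r by (simp add: algebra_simps add_pos_pos)
  also have "(1 + q0) * (1 + r) = 2 * (l * (1 + r) / (1 + l)) * (1 + l)\<^sup>2"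
    using l unfolding q0(2)[symmetric] by (simp add: field_simps power2_eq_square)
  finally have "(1 - l * r)\<^sup>2 / (1 + l)\<^sup>2 < 2 * (l * (1 + r) / (1 + l))"
    using l by (simp add: divide_less_eq)
  then have ends1: "a\<^sup>2 < 2 * (c + r)"
    unfolding cr by (simp add: a_def power_divide)
  have "2 * ((l - r) / (1 + l)) * (1 + l)\<^sup>2 = 1 + q0 - 2 * r * (1 + l)"
    using l unfolding q0(2)[symmetric] by (simp add: field_simps power2_eq_square)
  also have "\<dots> < (1 + r)\<^sup>2"
    using r(4) by (simp add: algebra_simps power2_eq_square) (smt (verit) zero_le_square)
  finally have "2 * ((l - r) / (1 + l)) < (1 + r)\<^sup>2 / (1 + l)\<^sup>2"
    using l by (simp add: less_divide_eq)
  then have ends2: "2 * c < (a + r)\<^sup>2"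
    unfolding ar by (simp add: c_def power_divide)
  have thick: "(1 - 2 * l) * 1 < l * a"
  proof -
    have "l\<^sup>2 * r \<le> 1 / 4 * (2 * q0)"
      using sq r by (intro mult_mono) auto
    then have "(1 - 2 * l) * (1 + l) < l * (1 - l * r)"
      using q0 by (simp add: q0_def power2_eq_square algebra_simps)
    then show ?thesis
      using l by (simp add: a_def less_divide_eq)
  qed
  have growth0: "(a + r) * (1 - l - l\<^sup>2) < l"
  proof -
    have "0 < r * q0"
      using r q0 by simp
    then have "(1 + r) * (1 - q0) < 1 + q0"
      using r(3) by (simp add: algebra_simps)
    then have half: "(1 + r) * ((1 - q0) / 2) < (1 + q0) / 2"
      by simp
    have eqs: "1 - l - l\<^sup>2 = (1 - q0) / 2" "l * (1 + l) = (1 + q0) / 2"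
      using q0(2) by (auto simp: power2_eq_square algebra_simps)
    have "(1 + r) * (1 - l - l\<^sup>2) < l * (1 + l)"
      unfolding eqs by (rule half)
    then show ?thesis
      using l unfolding ar by (simp add: divide_less_eq)
  qed
  have "\<forall>\<^sub>F N in sequentially. (l ^ N)\<^sup>2 * (l * (c + r)) + (a + r) * (1 - l - l\<^sup>2) < l"
    by (rule small_scale) (use growth0 in \<open>auto intro!: continuous_intros\<close>)
  moreover have "\<forall>\<^sub>F N in sequentially. (l ^ N)\<^sup>2 * (c + r)\<^sup>2 + a\<^sup>2 < 2 * (c + r)"
    by (rule small_scale) (use ends1 in \<open>auto intro!: continuous_intros\<close>)
  moreover have "\<forall>\<^sub>F N in sequentially. (l ^ N)\<^sup>2 < 1"
    by (rule small_scale) (auto intro!: continuous_intros)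
  ultimately have "\<forall>\<^sub>F N in sequentially. (l ^ N)\<^sup>2 * (l * (c + r)) + (a + r) * (1 - l - l\<^sup>2) < l
      \<and> (l ^ N)\<^sup>2 * (c + r)\<^sup>2 + a\<^sup>2 < 2 * (c + r) \<and> (l ^ N)\<^sup>2 < 1"
    by eventually_elim auto
  then obtain N where N: "(l ^ N)\<^sup>2 * (l * (c + r)) + (a + r) * (1 - l - l\<^sup>2) < l"
    "(l ^ N)\<^sup>2 * (c + r)\<^sup>2 + a\<^sup>2 < 2 * (c + r)" "(l ^ N)\<^sup>2 < 1"
    using eventually_happens trivial_limit_sequentially by blast
  define e where "e = (l ^ N)\<^sup>2"
  have "c + r < 1"
  proof -
    have "l * (1 + r) < 1 * (1 + r)"
      using l r by (intro mult_strict_right_mono) auto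
    also have "\<dots> \<le> 1 + l"
      using r by simp
    finally have "l * (1 + r) < 1 + l" .
    then show ?thesis
      using l unfolding cr by (simp add: divide_less_eq)
  qed
  then have "e * (c + r) < 1 * 1"
    using N(3) r c by (intro mult_strict_mono) (auto simp: e_def)
  then have e: "0 < e" "e * (c + r) < 1"
    using l by (auto simp: e_def)
  interpret increasing_pair l "chart_fst a r" "chart_snd e c r" a "a + r" "1 - e * (c + r)" 1
    using a r c e by (intro chart_increasing_pair) auto
  show ?thesis
  proof (rule coincidence_dim_pos)
    show "(1 - 2 * l) * 1 < l * a"
      by (rule thick)
    show "(a + r) * (1 - l - l\<^sup>2) < l * (1 - e * (c + r))"
      using N(1) by (simp add: e_def algebra_simps)
    show "chart_fst a r 0 < chart_snd e c r 1"
      using N(2) unfolding chart_ends(2)[OF r(1)] e_def by simp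
    have "0 \<le> e * c\<^sup>2"
      using e by simp
    then show "chart_snd e c r 0 < chart_fst a r 1"
      using ends2 unfolding chart_ends(4)[OF r(1)] by linarith
    show "0 < e * r"
      using e r by simp
    show "e * r * dist z w \<le> dist (chart N a c r z) (chart N a c r w)" for z w
      unfolding e_def using r(1) by (rule chart_expands)
    show "chart N a c r (x, y) \<in> E" if "x \<in> K" "y \<in> K" "chart_fst a r x = chart_snd e c r y" for x y
      using chart_in_E in_K that r(1) unfolding e_def by blast
  qed
qed

text \<open>
  No rescaling is needed here: \<open>N = 0\<close>, and the intervals are \<open>{1 - l..1}\<close> for \<open>a\<close> and \<open>{0..l}\<close> for \<open>c\<close>,
  with all slopes between \<open>1 - l\<close> and 1, hence at least 1/2. The relative loss per generation is then at most \<open>6 * \<theta>\<close>, while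
  \<open>l powr (2102 * \<theta>) \<le> exp (- 1051 * \<theta>)\<close>.
\<close>

lemma E_dim_ge:
  defines "\<theta> \<equiv> (1 - 2 * l) / l"
  assumes s: "2102 * \<theta> < 1"
  shows "ereal (1 - 2102 * \<theta>) \<le> hausdorff_dim E"
proof -
  have \<theta>: "0 < \<theta>"
    using l by (simp add: \<theta>_def)
  have l3: "3 / 10 < l"
    using s l by (simp add: \<theta>_def field_simps)
  interpret increasing_pair l "chart_fst (1 - l) l" "chart_snd 1 0 l" "1 - l" 1 "1 - l" 1
    using chart_increasing_pair[of "1 - l" l 0 1] l by simp
  show ?thesis
  proof (rule coincidence_dim_overlap[where w = "1 / 2" and F = "chart 0 (1 - l) 0 l" and \<kappa> = l])
    show "0 < 1 - 2102 * \<theta>"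
      using s by simp
    show "l powr (1 - (1 - 2102 * \<theta>)) \<le> 1 - (1 + 2 * 1) * (1 - 2 * l) / (l * (1 / 2))"
    proof -
      have "ln l \<le> - 1 / 2"
        using ln_le_minus_one[of l] l by simp
      then have "2102 * \<theta> * ln l \<le> 2102 * \<theta> * (- 1 / 2)"
        using \<theta> by (intro mult_left_mono) auto
      then have "l powr (2102 * \<theta>) \<le> exp (- (1051 * \<theta>))"
        using l by (simp add: powr_def)
      also have "\<dots> = 1 / exp (1051 * \<theta>)"
        by (simp add: exp_minus field_simps)
      also have "\<dots> \<le> 1 / (1 + 1051 * \<theta>)"
        using \<theta> exp_ge_add_one_self[of "1051 * \<theta>"] by (intro divide_left_mono mult_pos_pos) auto
      also have "\<dots> \<le> 1 - 6 * \<theta>"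
      proof -
        have "0 \<le> \<theta> * (1 - 2102 * \<theta>)"
          using \<theta> s by simp
        then have "1 \<le> (1 - 6 * \<theta>) * (1 + 1051 * \<theta>)"
          using \<theta> by (simp add: algebra_simps)
        then show ?thesis
          using \<theta> by (simp add: divide_le_eq)
      qed
      also have "1 - 6 * \<theta> = 1 - (1 + 2 * 1) * (1 - 2 * l) / (l * (1 / 2))"
        using l by (simp add: \<theta>_def field_simps)
      finally show ?thesis
        by simp
    qed
    show "chart_fst (1 - l) l 0 < chart_snd 1 0 l 1"
      using l3 square_le_chord[OF l3] unfolding chart_ends(2)[OF l(1)]
      by (simp add: power2_eq_square algebra_simps)
    show "chart_snd 1 0 l 0 < chart_fst (1 - l) l 1"
      unfolding chart_ends(4)[OF l(1)] by simp
    show "l * dist z w \<le> dist (chart 0 (1 - l) 0 l z) (chart 0 (1 - l) 0 l w)" for z w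
      using chart_expands[of l 0 z w "1 - l" 0] l by simp
    show "chart 0 (1 - l) 0 l (x, y) \<in> E" if "x \<in> K" "y \<in> K" "chart_fst (1 - l) l x = chart_snd 1 0 l y" for x y
      using chart_in_E[of "1 - l" l x 0 y 0] that K_right K_left l by simp
  qed (use l in auto)
qed

end

theorem theorem1p1:
  shows "(\<forall>l. lambda_inf < l \<and> l < 1/2 \<longrightarrow>
            infinite (cantor_circle l) \<and>
            (\<exists>p :: nat \<Rightarrow> real \<times> real.
               inj p \<and> range p \<subseteq> cantor_circle l \<and> p \<longlonglongrightarrow> (0, 1) \<and>
               inj (prod.swap \<circ> p) \<and> range (prod.swap \<circ> p) \<subseteq> cantor_circle l \<and>
               (prod.swap \<circ> p) \<longlonglongrightarrow> (1, 0)))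
       \<and> (\<forall>l. lambda_star < l \<and> l < 1/2 \<longrightarrow> cantor_circle l \<approx> (UNIV :: real set))
       \<and> (\<forall>l. lambda_H < l \<and> l < 1/2 \<longrightarrow> hausdorff_dim (cantor_circle l) > 0)
       \<and> (\<forall>l. 1/2 - 3 / 10 ^ 9 \<le> l \<and> l < 1/2 \<longrightarrow>
            hausdorff_dim (cantor_circle l) \<ge> ereal (1 - 2102 * ((1 - 2 * l) / l)))
       \<and> ((\<lambda>l. hausdorff_dim (cantor_circle l)) \<longlongrightarrow> 1) (at_left (1/2))"
proof (intro conjI allI impI)
  fix l :: real assume lam: "lambda_inf < l \<and> l < 1/2"
  have approx: "305 / 1000 < lambda_inf"
    using abs_less_iff[THEN iffD1, OF lambda_inf_approx] by simp
  interpret cantor_ratio l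
    using lam approx by unfold_locales auto
  have "2 * lambda_inf ^ 3 - 3 * lambda_inf\<^sup>2 + 4 * lambda_inf - 1 = 0"
    using theI'[OF lambda_inf_ex1] unfolding lambda_inf_def by blast
  then have "0 < 2 * l ^ 3 - 3 * l\<^sup>2 + 4 * l - 1"
    using lambda_inf_poly_strict_mono[of lambda_inf l] lam by simp
  then obtain p where p: "inj p" "range p \<subseteq> E" "p \<longlonglongrightarrow> (0, 1)"
    using sequence_to_pole lam approx by auto
  show "infinite E"
    using p(1,2) finite_subset range_inj_infinite by blast
  have "inj (prod.swap \<circ> p)"
    using p(1) by (simp add: inj_compose)
  moreover have "range (prod.swap \<circ> p) \<subseteq> E"
    using p(2) E_swap by (auto simp: image_subset_iff)
  moreover have "(prod.swap \<circ> p) \<longlonglongrightarrow> (1, 0)"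
    using tendsto_Pair[OF tendsto_snd[OF p(3)] tendsto_fst[OF p(3)]] by (simp add: comp_def prod.swap_def)
  ultimately show "\<exists>p :: nat \<Rightarrow> real \<times> real.
               inj p \<and> range p \<subseteq> cantor_circle l \<and> p \<longlonglongrightarrow> (0, 1) \<and>
               inj (prod.swap \<circ> p) \<and> range (prod.swap \<circ> p) \<subseteq> cantor_circle l \<and>
               (prod.swap \<circ> p) \<longlonglongrightarrow> (1, 0)"
    using p by blast
next
  have "(172 / 100)\<^sup>2 < (3 :: real)"
    by (simp add: power2_eq_square)
  then have "172 / 100 < sqrt (3 :: real)"
    by (rule real_less_rsqrt)
  then have star: "36 / 100 \<le> lambda_star"
    by (simp add: lambda_star_def)
  have star_root: "2 * lambda_star\<^sup>2 + 2 * lambda_star - 1 = 0"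
    by (simp add: lambda_star_def power2_eq_square field_simps)
  have dim_pos: "0 < hausdorff_dim (cantor_circle l)" if "lambda_star < l" "l < 1/2" for l
  proof -
    interpret cantor_ratio l
      using that star by unfold_locales auto
    have "lambda_star\<^sup>2 < l\<^sup>2"
      using that star by (intro power_strict_mono) auto
    then show ?thesis
      using star_root that star by (intro E_dim_pos) auto
  qed
  show "cantor_circle l \<approx> (UNIV :: real set)" if "lambda_star < l \<and> l < 1/2" for l
  proof -
    interpret cantor_ratio l
      using that star by unfold_locales auto
    show ?thesis
      using that by (intro E_continuum dim_pos) auto
  qed
  show "0 < hausdorff_dim (cantor_circle l)" if "lambda_H < l \<and> l < 1/2" for l
  proof -
    have "sqrt 3 \<le> (1733 / 1000 :: real)" "1415 / 1001 \<le> sqrt (2 :: real)"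
      by (rule real_le_lsqrt real_le_rsqrt; simp add: power2_eq_square)+
    then have "lambda_star \<le> lambda_H"
      by (simp add: lambda_star_def lambda_H_def)
    then show ?thesis
      using that by (intro dim_pos) auto
  qed
next
  have ge: "ereal (1 - 2102 * ((1 - 2 * l) / l)) \<le> hausdorff_dim (cantor_circle l)"
    if "1/2 - 3 / 10 ^ 9 \<le> l" "l < 1/2" for l :: real
  proof -
    have "4 / 10 < l"
      using that by simp
    then interpret cantor_ratio l
      using that by unfold_locales auto
    have "2102 * ((1 - 2 * l) / l) < 1"
      using that l by (simp add: field_simps)
    then show ?thesis
      by (rule E_dim_ge)
  qed
  then show "ereal (1 - 2102 * ((1 - 2 * l) / l)) \<le> hausdorff_dim (cantor_circle l)"
    if "1/2 - 3 / 10 ^ 9 \<le> l \<and> l < 1/2" for l :: real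
    using that by blast
  show "((\<lambda>l. hausdorff_dim (cantor_circle l)) \<longlongrightarrow> 1) (at_left (1/2))"
  proof (rule tendsto_sandwich[OF _ _ _ tendsto_const])
    have "\<forall>\<^sub>F l in at_left (1/2 :: real). l \<in> {1/2 - 3 / 10 ^ 9<..<1/2}"
      by (rule eventually_at_left_real) simp
    then show "\<forall>\<^sub>F l in at_left (1/2). ereal (1 - 2102 * ((1 - 2 * l) / l)) \<le> hausdorff_dim (cantor_circle l)"
      by eventually_elim (rule ge; simp)
    show "\<forall>\<^sub>F l in at_left (1/2). hausdorff_dim (cantor_circle l) \<le> 1"
      by (intro always_eventually allI hausdorff_dim_circle_le) (auto simp: cantor_circle_def)
    have "((\<lambda>l :: real. 1 - 2102 * ((1 - 2 * l) / l)) \<longlongrightarrow> 1 - 2102 * ((1 - 2 * (1/2)) / (1/2))) (at_left (1/2))"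
      by (intro tendsto_intros) auto
    then show "((\<lambda>l :: real. ereal (1 - 2102 * ((1 - 2 * l) / l))) \<longlongrightarrow> 1) (at_left (1/2))"
      by (simp add: one_ereal_def)
  qed
qed

end
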